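(* Let $n$, $s$, $k$ be positive integers with $n > \max(2^5 s\log_2(sk),\, s)$, and let $c$ be a real number with $$c \geq n^{k-1} + \max\left(14\,s\,n^{k-\frac 32}\sqrt{\log(2ks)},\ 8k\,n^{k-1}\log(2ks)\right) + 2^{15} s^3\big(\log_2(ks)\big)^3 n^{k-3}.$$ Then the sequence $f_1,\dots,f_s$ given by $f_i = (i-1)n^{k-1}+c$ for $i=1,\dots,s$ is satisfying (with respect to $n$, $s$, $k$).
   Context: Let $[n]=\{1,\dots,n\}$. Two tuples $F,G\in[n]^k$ are disjoint if, for each $i\in\{1,\dots,k\}$, the $i$-th coordinate of $F$ is different from the $i$-th coordinate of $G$. Let $n\ge s$ and $k$ be positive integers. A sequence $f_1,\dots,f_s$ is called satisfying if for every list of subsets $\mathcal F_1,\dots,\mathcal F_s\subseteq [n]^k$ with $|\mathcal F_i|>f_i$ for all $i$, there exist pairwise disjoint tuples $F_1\in\mathcal F_1,\dots,F_s\in\mathcal F_s$ (a rainbow matching). Here $\log$ denotes the natural logarithm and $\log_2$ the base-2 logarithm. *)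

theory Defs
  imports Complex_Main "HOL-Library.FuncSet"
begin

text \<open>The set of \<open>k\<close>-tuples over \<open>{1..n}\<close>; a tuple is an extensional function on \<open>{1..k}\<close>.\<close>

definition tuples :: "nat \<Rightarrow> nat \<Rightarrow> (nat \<Rightarrow> nat) set" where
  "tuples n k = {1..k} \<rightarrow>\<^sub>E {1..n}"

definition disjoint_tuples :: "nat \<Rightarrow> (nat \<Rightarrow> nat) \<Rightarrow> (nat \<Rightarrow> nat) \<Rightarrow> bool" where
  "disjoint_tuples k F G \<longleftrightarrow> (\<forall>i\<in>{1..k}. F i \<noteq> G i)"

definition rainbow_matching ::
    "nat \<Rightarrow> nat \<Rightarrow> (nat \<Rightarrow> (nat \<Rightarrow> nat) set) \<Rightarrow> (nat \<Rightarrow> nat \<Rightarrow> nat) \<Rightarrow> bool" where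
  "rainbow_matching s k \<F> F \<longleftrightarrow>
     (\<forall>i\<in>{1..s}. F i \<in> \<F> i) \<and>
     pairwise (\<lambda>i j. disjoint_tuples k (F i) (F j)) {1..s}"

text \<open>A sequence \<open>f\<^sub>1, \<dots>, f\<^sub>s\<close> is a function on \<open>nat\<close> of which only the values at
  \<open>1, \<dots>, s\<close> matter; the same convention applies to the list of families.\<close>

definition satisfying :: "nat \<Rightarrow> nat \<Rightarrow> nat \<Rightarrow> (nat \<Rightarrow> real) \<Rightarrow> bool" where
  "satisfying n s k f \<longleftrightarrow>
     (\<forall>\<F>. (\<forall>i\<in>{1..s}. \<F> i \<subseteq> tuples n k \<and> real (card (\<F> i)) > f i) \<longrightarrow>
       (\<exists>F. rainbow_matching s k \<F> F))"

end

theory Submission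
  imports Defs "HOL-Combinatorics.Permutations"
begin

text \<open>Regard a tuple as the set of its \<open>k\<close> vertices, a vertex being a pair of a coordinate and a value;
  two tuples are disjoint exactly when these sets are. The proof separates structure from
  pseudorandomness. Let \<open>R = 32 s log\<^sub>2(sk)\<close> and \<open>m = 2(s - 1)\<close>.

  \<^bold>\<open>Cores.\<close> Call a set \<open>S\<close> of vertices a core of a family if some nonempty subfamily \<open>G\<close> lies above
  \<open>S\<close> and at most a fraction \<open>R\<^sup>-\<^sup>t\<close> of \<open>G\<close> contains any given \<open>t\<close> vertices outside \<open>S\<close>. A maximality
  argument (\<open>card_uncovered_by_cores\<close>) shows that all but \<open>R\<^sup>3 n\<^sup>k\<^sup>-\<^sup>3\<close> tuples of each family lie above
  a core of at most two vertices; this is the last summand of the bound on \<open>c\<close>. If the families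
  have pairwise disjoint cores of this kind, then they have a rainbow matching
  (\<open>rainbow_matching_of_cores\<close>): colour the vertices at random with \<open>s\<close> colours; by the spread
  lemma each subfamily \<open>G\<close> has, with probability above \<open>1 - 1/s\<close>, a member whose part
  outside the core lies in its own colour class.

  \<^bold>\<open>Robust sets.\<close> It remains to choose disjoint cores of size at most two. The other \<open>s - 1\<close> cores
  occupy at most \<open>m\<close> vertices, so one may as well work with robust sets: sets such that any \<open>m\<close>
  vertices that avoid the set also avoid some core. Robust sets can be exchanged for cores one
  after the other. The gain is that they are few: unless the empty set is robust, some \<open>m\<close>
  vertices meet all robust sets, and a vertex that is not robust by itself lies in at most \<open>m\<close>
  robust pairs.

  \<^bold>\<open>A random partition into disjoint tuples.\<close> Take \<open>n\<close> pairwise disjoint tuples given by a uniformly random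
  bijection in each coordinate. The expected number of them that lie above a robust set of the \<open>i\<close>-th family
  exceeds \<open>i + \<lambda>\<close>, where \<open>\<lambda>\<close> is the second summand of the bound on \<open>c\<close> divided by \<open>n\<^sup>k\<^sup>-\<^sup>1\<close>. If the actual
  number is at least \<open>i\<close> for every \<open>i\<close>, then distinct tuples can be chosen greedily, and the
  robust sets below them are disjoint. So all rests on a lower tail bound. The plain
  Chernoff variance, which is of order \<open>s\<close>, would be too large. But a robust
  vertex lies in exactly one of the \<open>n\<close> tuples, so randomness enters only through robust pairs and through
  tuples that are hit twice; with at most \<open>m\<close> robust vertices and \<open>m\<^sup>2\<close> other robust pairs this
  gives a variance of order \<open>s\<^sup>2/n\<close>, as needed. The coordinates are revealed one
  at a time, keeping the sum over \<open>i\<close> of the exponential moments from growing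
  (\<open>matching_with_many_hits\<close>); a single coordinate is handled by an exchangeable pair argument for
  sums \<open>\<Sum>\<^sub>j a(j, \<pi>(j))\<close> over a random permutation (\<open>perm_sum_mgf\<close>).\<close>

section \<open>Binomial random subsets\<close>

text \<open>The expectation of \<open>g W\<close> when \<open>W\<close> contains each element of \<open>V\<close> independently with probability \<open>p\<close>.\<close>

definition bin_avg :: "real \<Rightarrow> 'v set \<Rightarrow> ('v set \<Rightarrow> real) \<Rightarrow> real" where
  "bin_avg p V g = (\<Sum>W\<in>Pow V. p ^ card W * (1 - p) ^ card (V - W) * g W)"

lemma bin_avg_empty [simp]: "bin_avg p {} g = g {}"
  by (simp add: bin_avg_def)

lemma bin_avg_insert:
  assumes "finite V" "v \<notin> V"
  shows "bin_avg p (insert v V) g =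
    p * bin_avg p V (\<lambda>W. g (insert v W)) + (1 - p) * bin_avg p V g"
proof -
  have fin: "finite W" "v \<notin> W" if "W \<in> Pow V" for W
    using that assms finite_subset by auto
  have disj: "Pow V \<inter> insert v ` Pow V = {}"
    using assms by auto
  have inj: "inj_on (insert v) (Pow V)"
    using assms by (auto simp: inj_on_def)
  have "bin_avg p (insert v V) g =
      (\<Sum>W\<in>Pow V. p ^ card W * (1 - p) ^ card (insert v V - W) * g W) +
      (\<Sum>W\<in>insert v ` Pow V. p ^ card W * (1 - p) ^ card (insert v V - W) * g W)"
    unfolding bin_avg_def Pow_insert using assms disj by (intro sum.union_disjoint) auto
  also have "(\<Sum>W\<in>Pow V. p ^ card W * (1 - p) ^ card (insert v V - W) * g W) =
      (1 - p) * bin_avg p V g"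
    unfolding bin_avg_def sum_distrib_left
  proof (intro sum.cong refl)
    fix W assume W: "W \<in> Pow V"
    have "insert v V - W = insert v (V - W)" using fin[OF W] by auto
    then show "p ^ card W * (1 - p) ^ card (insert v V - W) * g W =
        (1 - p) * (p ^ card W * (1 - p) ^ card (V - W) * g W)"
      using assms by simp
  qed
  also have "(\<Sum>W\<in>insert v ` Pow V. p ^ card W * (1 - p) ^ card (insert v V - W) * g W) =
      p * bin_avg p V (\<lambda>W. g (insert v W))"
    unfolding bin_avg_def sum_distrib_left sum.reindex[OF inj] o_def
  proof (intro sum.cong refl)
    fix W assume W: "W \<in> Pow V"
    have "insert v V - insert v W = V - W" using assms by auto
    then show "p ^ card (insert v W) * (1 - p) ^ card (insert v V - insert v W) * g (insert v W) =
        p * (p ^ card W * (1 - p) ^ card (V - W) * g (insert v W))"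
      using fin[OF W] by simp
  qed
  finally show ?thesis by simp
qed

lemma bin_avg_cong:
  "(\<And>W. W \<subseteq> V \<Longrightarrow> g W = h W) \<Longrightarrow> bin_avg p V g = bin_avg p V h"
  by (simp add: bin_avg_def)

lemma bin_avg_mono:
  assumes "0 \<le> p" "p \<le> 1" "\<And>W. W \<subseteq> V \<Longrightarrow> g W \<le> h W"
  shows "bin_avg p V g \<le> bin_avg p V h"
  unfolding bin_avg_def using assms by (intro sum_mono mult_left_mono) auto

lemma bin_avg_cmult: "bin_avg p V (\<lambda>W. c * g W) = c * bin_avg p V g"
  by (simp add: bin_avg_def sum_distrib_left mult_ac)

lemma bin_avg_add: "bin_avg p V (\<lambda>W. g W + h W) = bin_avg p V g + bin_avg p V h"
  by (simp add: bin_avg_def sum.distrib distrib_left)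

lemma bin_avg_diff: "bin_avg p V (\<lambda>W. g W - h W) = bin_avg p V g - bin_avg p V h"
  by (simp add: bin_avg_def sum_subtractf right_diff_distrib)

lemma bin_avg_sum: "bin_avg p V (\<lambda>W. \<Sum>a\<in>A. g a W) = (\<Sum>a\<in>A. bin_avg p V (g a))"
  unfolding bin_avg_def sum_distrib_left by (rule sum.swap)

lemma bin_avg_const: "finite V \<Longrightarrow> bin_avg p V (\<lambda>W. c) = c"
  by (induction V rule: finite_induct) (simp_all add: bin_avg_insert algebra_simps)

text \<open>Change of measure: the random set \<open>X \<union> W\<close> has the law of \<open>W\<close> conditioned on \<open>X \<subseteq> W\<close>, an event of
  probability \<open>p\<^sup>|\<^sup>X\<^sup>|\<close>. This lets the fragment lemma average over \<open>Z = X \<union> W\<close> in place of \<open>W\<close>.\<close>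

lemma bin_avg_union:
  assumes "finite V" "X \<subseteq> V"
  shows "bin_avg p V (\<lambda>Z. if X \<subseteq> Z then \<phi> Z else 0) =
    p ^ card X * bin_avg p V (\<lambda>W. \<phi> (X \<union> W))"
  using assms
proof (induction V arbitrary: X \<phi> rule: finite_induct)
  case empty
  then show ?case by simp
next
  case (insert v V)
  show ?case
  proof (cases "v \<in> X")
    case False
    then have X: "X \<subseteq> V" using insert.prems by auto
    have *: "(X \<subseteq> insert v W) = (X \<subseteq> W)" "X \<union> insert v W = insert v (X \<union> W)" for W
      using False by auto
    show ?thesis
      using insert.hyps insert.IH[OF X, of \<phi>] insert.IH[OF X, of "\<lambda>Z. \<phi> (insert v Z)"]
      by (simp add: bin_avg_insert * algebra_simps)
  next
    case True
    then obtain X' where X': "X = insert v X'" "v \<notin> X'" by (meson Set.set_insert)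
    then have sub: "X' \<subseteq> V" "finite X'"
      using insert.prems insert.hyps by (auto intro: finite_subset)
    have z: "bin_avg p V (\<lambda>Z. if X \<subseteq> Z then \<phi> Z else 0) = 0"
    proof -
      have "bin_avg p V (\<lambda>Z. if X \<subseteq> Z then \<phi> Z else 0) = bin_avg p V (\<lambda>Z. 0 * 0)"
        using insert.hyps True by (intro bin_avg_cong) auto
      then show ?thesis by (simp add: bin_avg_def)
    qed
    have *: "(X \<subseteq> insert v Z) = (X' \<subseteq> Z)" for Z using X' by auto
    have u: "X \<union> insert v W = insert v (X' \<union> W)" "X \<union> W = insert v (X' \<union> W)" for W
      using X' by auto
    show ?thesis
      using insert.hyps insert.IH[OF sub(1), of "\<lambda>Z. \<phi> (insert v Z)"] z X' sub
      unfolding bin_avg_insert[OF insert.hyps(1,2)] *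
      by (simp add: u algebra_simps)
  qed
qed

lemma bin_avg_superset:
  assumes "finite V" "X \<subseteq> V"
  shows "bin_avg p V (\<lambda>Z. if X \<subseteq> Z then 1 else 0) = p ^ card X"
  using bin_avg_union[OF assms, of p "\<lambda>_. 1"] bin_avg_const[OF assms(1), of p 1] by simp

text \<open>Sprinkling: a random set may be revealed in two rounds, the second one among the elements that
  the first has missed.\<close>

lemma bin_avg_two_step:
  assumes "finite V"
  shows "bin_avg (1 - (1 - p) * (1 - q)) V g =
    bin_avg p V (\<lambda>W1. bin_avg q (V - W1) (\<lambda>W2. g (W1 \<union> W2)))"
  using assms
proof (induction V arbitrary: g rule: finite_induct)
  case empty
  then show ?case by simp
next
  case (insert v V)
  have A: "bin_avg p V (\<lambda>W1. bin_avg q (insert v V - insert v W1) (\<lambda>W2. g (insert v W1 \<union> W2)))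
      = bin_avg p V (\<lambda>W1. bin_avg q (V - W1) (\<lambda>W2. g (insert v (W1 \<union> W2))))"
  proof (rule bin_avg_cong)
    fix W assume "W \<subseteq> V"
    then have "insert v V - insert v W = V - W" using insert.hyps by auto
    then show "bin_avg q (insert v V - insert v W) (\<lambda>W2. g (insert v W \<union> W2)) =
        bin_avg q (V - W) (\<lambda>W2. g (insert v (W \<union> W2)))" by simp
  qed
  have B: "bin_avg p V (\<lambda>W1. bin_avg q (insert v V - W1) (\<lambda>W2. g (W1 \<union> W2)))
      = q * bin_avg p V (\<lambda>W1. bin_avg q (V - W1) (\<lambda>W2. g (insert v (W1 \<union> W2))))
      + (1 - q) * bin_avg p V (\<lambda>W1. bin_avg q (V - W1) (\<lambda>W2. g (W1 \<union> W2)))"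
  proof -
    have "bin_avg q (insert v V - W) (\<lambda>W2. g (W \<union> W2)) =
         q * bin_avg q (V - W) (\<lambda>W2. g (insert v (W \<union> W2))) +
         (1 - q) * bin_avg q (V - W) (\<lambda>W2. g (W \<union> W2))" if W: "W \<subseteq> V" for W
    proof -
      have e: "insert v V - W = insert v (V - W)" using insert.hyps W by auto
      have f: "finite (V - W)" "v \<notin> V - W" using insert.hyps by auto
      show ?thesis
        unfolding e bin_avg_insert[OF f] by simp
    qed
    then show ?thesis
      by (subst bin_avg_cong, assumption) (simp only: bin_avg_add bin_avg_cmult)
  qed
  show ?case
    unfolding bin_avg_insert[OF insert.hyps(1,2)] A B insert.IH
    by (simp add: algebra_simps)
qed

section \<open>The spread lemma\<close>

text \<open>One round of the spread lemma. For a random \<open>W\<close>, every member \<open>X a\<close> is replaced by a fragment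
  \<open>X b - W\<close> with \<open>X b \<subseteq> X a \<union> W\<close>; as the fragment lies inside \<open>X a\<close>, the fragments inherit the spread
  condition. If \<open>b\<close> is chosen so as to minimise the fragment, then on average at most a fraction
  \<open>1 / log\<^sub>2 (\<delta>R)\<close> of the total size is left.

  The reason: put \<open>Z = X a \<union> W\<close>. The minimum is at most the average over all \<open>c\<close> with
  \<open>X c \<subseteq> Z\<close>, taken with the posterior weights \<open>\<delta>\<^sup>-\<^sup>|\<^sup>X \<^sup>c\<^sup>|\<close>, and there the fragment is contained in \<open>X a \<inter> X c\<close>. So
  it suffices to bound the expected intersection of two members that are drawn
  independently given \<open>Z\<close>. Large intersections are exponentially unlikely for
  two members drawn without reference to \<open>Z\<close>, by spreadness; an entropy comparison carries this over to the conditional pair.\<close>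

lemma fragment_lemma:
  fixes X :: "'a \<Rightarrow> 'v set" and \<delta> R :: real
  assumes finV: "finite V" and finI: "finite I" and XV: "\<And>a. a \<in> I \<Longrightarrow> X a \<subseteq> V"
    and \<delta>: "0 < \<delta>" "\<delta> \<le> 1" and R: "0 < R" "1 < \<delta> * R"
    and spread: "\<And>T. T \<subseteq> V \<Longrightarrow> R ^ card T * real (card {a \<in> I. T \<subseteq> X a}) \<le> real (card I)"
  shows "\<exists>b. (\<forall>W. \<forall>a\<in>I. b W a \<in> I \<and> X (b W a) \<subseteq> X a \<union> W) \<and>
    ln (\<delta> * R) * bin_avg \<delta> V (\<lambda>W. \<Sum>a\<in>I. real (card (X (b W a) - W)))
      \<le> ln 2 * (\<Sum>a\<in>I. real (card (X a)))"
proof -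
  define P where "P W a b \<longleftrightarrow> b \<in> I \<and> X b \<subseteq> X a \<union> W" for W a b
  define b where "b W a = arg_min (\<lambda>c. card (X c - W)) (P W a)" for W a
  have P_b: "P W a (b W a)" if "a \<in> I" for W a
    unfolding b_def by (rule arg_min_natI[where k = a]) (use that in \<open>auto simp: P_def\<close>)
  have b_min: "card (X (b W a) - W) \<le> card (X c - W)" if "P W a c" for W a c
    unfolding b_def by (rule arg_min_nat_le[where m = "\<lambda>c. card (X c - W)"]) (rule that)
  have finX: "finite (X a)" if "a \<in> I" for a
    using XV[OF that] finV finite_subset by auto
  define wt where "wt a Z = (if X a \<subseteq> Z then (1 / \<delta>) ^ card (X a) else 0)" for a Z
  define N where "N Z = (\<Sum>a\<in>I. wt a Z)" for Z
  define M where "M = real (card I)"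
  define j where "j a c = card (X a \<inter> X c)" for a c
  \<comment> \<open>up to normalisation, the joint density of two members drawn independently given \<open>Z\<close>\<close>
  define q where "q a c Z = wt a Z * wt c Z / N Z" for a c Z
  have wt0: "0 \<le> wt a Z" for a Z using \<delta> by (simp add: wt_def)
  have N0: "0 \<le> N Z" for Z unfolding N_def by (intro sum_nonneg wt0)
  have wt_le_N: "wt a Z \<le> N Z" if "a \<in> I" for a Z
    unfolding N_def using finI that wt0 by (intro member_le_sum) auto
  have wt_z: "wt a Z = 0" if "a \<in> I" "N Z = 0" for a Z
    using wt_le_N[OF that(1), of Z] wt0[of a Z] that(2) by simp
  have q0: "0 \<le> q a c Z" for a c Z
    unfolding q_def using wt0 N0 by simp
  have sum_q: "(\<Sum>c\<in>I. q a c Z) = wt a Z" if "a \<in> I" for a Z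
  proof (cases "N Z = 0")
    case True
    then show ?thesis using wt_z[OF that True] by (simp add: q_def)
  next
    case False
    have "(\<Sum>c\<in>I. q a c Z) = wt a Z * N Z / N Z"
      unfolding q_def N_def[of Z] sum_divide_distrib[symmetric] sum_distrib_left[symmetric] ..
    then show ?thesis using False by simp
  qed
  have avg_wt: "bin_avg \<delta> V (wt a) = 1" if "a \<in> I" for a
  proof -
    have "bin_avg \<delta> V (wt a) = bin_avg \<delta> V (\<lambda>Z. (1/\<delta>) ^ card (X a) * (if X a \<subseteq> Z then 1 else 0))"
      by (rule bin_avg_cong) (simp add: wt_def)
    also have "\<dots> = (1/\<delta>) ^ card (X a) * \<delta> ^ card (X a)"
      by (simp only: bin_avg_cmult bin_avg_superset[OF finV XV[OF that]])
    also have "\<dots> = 1" using \<delta> by (simp flip: power_mult_distrib)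
    finally show ?thesis .
  qed
  have avg_wt2: "bin_avg \<delta> V (\<lambda>Z. wt a Z * wt c Z) = (1/\<delta>) ^ j a c" if "a \<in> I" "c \<in> I" for a c
  proof -
    have "bin_avg \<delta> V (\<lambda>Z. wt a Z * wt c Z) = bin_avg \<delta> V (\<lambda>Z. (1/\<delta>) ^ (card (X a) + card (X c)) *
        (if X a \<union> X c \<subseteq> Z then 1 else 0))"
      by (rule bin_avg_cong) (simp add: wt_def power_add)
    also have "\<dots> = (1/\<delta>) ^ (card (X a) + card (X c)) * \<delta> ^ card (X a \<union> X c)"
      using XV[OF that(1)] XV[OF that(2)]
      by (simp only: bin_avg_cmult) (subst bin_avg_superset[OF finV], auto)
    also have "card (X a) + card (X c) = j a c + card (X a \<union> X c)"
      unfolding j_def using card_Un_Int[OF finX[OF that(1)] finX[OF that(2)]] by simp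
    also have "(1/\<delta>) ^ (j a c + card (X a \<union> X c)) * \<delta> ^ card (X a \<union> X c) = (1/\<delta>) ^ j a c"
      using \<delta> by (simp add: power_add power_one_over)
    finally show ?thesis .
  qed
  have t_le: "real (card (X (b W a) - W)) \<le> (\<Sum>c\<in>I. wt c (X a \<union> W) * real (j a c)) / N (X a \<union> W)"
    if a: "a \<in> I" for W a
  proof -
    define Z where "Z = X a \<union> W"
    have "0 < wt a Z" using \<delta> by (simp add: wt_def Z_def)
    then have Np: "0 < N Z" using wt_le_N[OF a, of Z] by linarith
    have "real (card (X (b W a) - W)) * N Z = (\<Sum>c\<in>I. wt c Z * real (card (X (b W a) - W)))"
      unfolding N_def sum_distrib_left by (intro sum.cong refl mult.commute)
    also have "\<dots> \<le> (\<Sum>c\<in>I. wt c Z * real (j a c))"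
    proof (rule sum_mono)
      fix c assume c: "c \<in> I"
      show "wt c Z * real (card (X (b W a) - W)) \<le> wt c Z * real (j a c)"
      proof (cases "X c \<subseteq> Z")
        case True
        then have "card (X (b W a) - W) \<le> card (X c - W)"
          using c by (intro b_min) (auto simp: P_def Z_def)
        also have "\<dots> \<le> card (X a \<inter> X c)"
          using True finX[OF a] by (intro card_mono) (auto simp: Z_def)
        finally show ?thesis using wt0[of c Z] unfolding j_def by (intro mult_left_mono) auto
      next
        case False
        then show ?thesis by (simp add: wt_def)
      qed
    qed
    finally show ?thesis using Np unfolding Z_def[symmetric] by (simp add: field_simps)
  qed
  have t_avg: "bin_avg \<delta> V (\<lambda>W. real (card (X (b W a) - W))) \<le>
      bin_avg \<delta> V (\<lambda>Z. \<Sum>c\<in>I. q a c Z * real (j a c))" if a: "a \<in> I" for a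
  proof -
    define \<Psi> where "\<Psi> Z = (\<Sum>c\<in>I. wt c Z * real (j a c)) / N Z" for Z
    have "bin_avg \<delta> V (\<lambda>W. real (card (X (b W a) - W))) \<le> bin_avg \<delta> V (\<lambda>W. \<Psi> (X a \<union> W))"
      using \<delta> t_le[OF a] by (intro bin_avg_mono) (auto simp: \<Psi>_def)
    also have "\<dots> = (1/\<delta>) ^ card (X a) * (\<delta> ^ card (X a) * bin_avg \<delta> V (\<lambda>W. \<Psi> (X a \<union> W)))"
      using \<delta> by (simp add: power_one_over)
    also have "\<dots> = (1/\<delta>) ^ card (X a) * bin_avg \<delta> V (\<lambda>Z. if X a \<subseteq> Z then \<Psi> Z else 0)"
      by (simp only: bin_avg_union[OF finV XV[OF a]])
    also have "\<dots> = bin_avg \<delta> V (\<lambda>Z. wt a Z * \<Psi> Z)"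
      unfolding bin_avg_cmult[symmetric] by (rule bin_avg_cong) (simp add: wt_def)
    also have "\<dots> = bin_avg \<delta> V (\<lambda>Z. \<Sum>c\<in>I. q a c Z * real (j a c))"
      by (rule bin_avg_cong)
        (simp add: \<Psi>_def q_def sum_distrib_left sum_divide_distrib mult_ac)
    finally show ?thesis .
  qed
  have key: "q a c Z * (real (j a c) * ln (\<delta> * R)) \<le> q a c Z * (ln 2 * real (card (X a))) +
      ((\<delta> * R) ^ j a c / (2 ^ card (X a) * M)) * (wt a Z * wt c Z) - q a c Z + (M * q a c Z / N Z - q a c Z)"
    if a: "a \<in> I" and c: "c \<in> I" for a c Z
  proof (cases "N Z = 0")
    case True
    then show ?thesis using wt_z[OF a True] by (simp add: q_def)
  next
    case False
    then have Np: "0 < N Z" using N0[of Z] by linarith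
    have Mp: "0 < M" unfolding M_def using a finI card_gt_0_iff by fastforce
    have dR: "0 < \<delta> * R" using R by linarith
    \<comment> \<open>the entropy inequality in elementary form: \<open>ln (x y) \<le> (x - 1) + (y - 1)\<close>, where \<open>x\<close> and \<open>y\<close> are chosen so that \<open>q x\<close> and \<open>q y\<close> both sum to at most \<open>card I\<close> on average\<close>
    define x where "x = (\<delta> * R) ^ j a c / 2 ^ card (X a) * (N Z / M)"
    define y where "y = M / N Z"
    have xp: "0 < x" unfolding x_def using dR Np Mp by simp
    have yp: "0 < y" unfolding y_def using Np Mp by simp
    have xy: "x * y = (\<delta> * R) ^ j a c / 2 ^ card (X a)"
      unfolding x_def y_def using Np Mp by simp
    have "real (j a c) * ln (\<delta> * R) - real (card (X a)) * ln 2 = ln (x * y)"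
    proof -
      have "ln (u ^ p / 2 ^ r) = real p * ln u - real r * ln 2" if "0 < u" for u :: real and p r
        using that by (simp add: ln_div ln_realpow)
      then show ?thesis using xy dR by simp
    qed
    also have "\<dots> = ln x + ln y" using xp yp by (simp add: ln_mult)
    also have "\<dots> \<le> (x - 1) + (y - 1)"
      using ln_le_minus_one[OF xp] ln_le_minus_one[OF yp] by simp
    finally have *: "real (j a c) * ln (\<delta> * R) \<le> real (card (X a)) * ln 2 + (x - 1) + (y - 1)" by simp
    have qx: "q a c Z * x = ((\<delta> * R) ^ j a c / (2 ^ card (X a) * M)) * (wt a Z * wt c Z)"
      unfolding q_def x_def using Np by simp
    have qy: "q a c Z * y = M * q a c Z / N Z" unfolding y_def by simp
    show ?thesis using mult_left_mono[OF * q0[of a c Z]] qx qy by (simp add: algebra_simps)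
  qed
  let ?E = "bin_avg \<delta> V (\<lambda>W. \<Sum>a\<in>I. real (card (X (b W a) - W)))"
  have main_sum: "(\<Sum>a\<in>I. \<Sum>c\<in>I. (\<delta> * R) ^ j a c / (2 ^ card (X a) * M) * (1/\<delta>) ^ j a c) \<le> M"
  proof -
    have inner: "(\<Sum>c\<in>I. (\<delta> * R) ^ j a c / (2 ^ card (X a) * M) * (1/\<delta>) ^ j a c) \<le> 1"
      if a: "a \<in> I" for a
    proof -
      have Mp: "0 < M" unfolding M_def using a finI card_gt_0_iff by fastforce
      \<comment> \<open>one term of the sum over \<open>T\<close>, namely \<open>T = X a \<inter> X c\<close>, already accounts for \<open>R ^ j a c\<close>\<close>
      have "(\<Sum>c\<in>I. R ^ j a c) \<le> (\<Sum>c\<in>I. \<Sum>T\<in>Pow (X a). if T \<subseteq> X c then R ^ card T else 0)"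
      proof (rule sum_mono)
        fix c assume "c \<in> I"
        have "R ^ j a c = (\<Sum>T\<in>{X a \<inter> X c}. if T \<subseteq> X c then R ^ card T else 0)"
          by (simp add: j_def)
        also have "\<dots> \<le> (\<Sum>T\<in>Pow (X a). if T \<subseteq> X c then R ^ card T else 0)"
          using finX[OF a] R by (intro sum_mono2) auto
        finally show "R ^ j a c \<le> (\<Sum>T\<in>Pow (X a). if T \<subseteq> X c then R ^ card T else 0)" .
      qed
      also have "\<dots> = (\<Sum>T\<in>Pow (X a). R ^ card T * real (card {c \<in> I. T \<subseteq> X c}))"
        using finI by (subst sum.swap) (simp add: sum.If_cases Int_def mult.commute)
      also have "\<dots> \<le> (\<Sum>T\<in>Pow (X a). M)"
        using XV[OF a] unfolding M_def by (intro sum_mono spread) auto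
      also have "\<dots> = 2 ^ card (X a) * M"
        using finX[OF a] by (simp add: card_Pow)
      finally have A: "(\<Sum>c\<in>I. R ^ j a c) \<le> 2 ^ card (X a) * M" .
      have "(\<Sum>c\<in>I. (\<delta> * R) ^ j a c / (2 ^ card (X a) * M) * (1/\<delta>) ^ j a c)
          = (\<Sum>c\<in>I. R ^ j a c) / (2 ^ card (X a) * M)"
        unfolding sum_divide_distrib using \<delta>
        by (intro sum.cong refl) (simp add: power_mult_distrib power_one_over)
      also have "\<dots> \<le> 1" using A Mp by simp
      finally show ?thesis .
    qed
    then have "(\<Sum>a\<in>I. \<Sum>c\<in>I. (\<delta> * R) ^ j a c / (2 ^ card (X a) * M) * (1/\<delta>) ^ j a c) \<le> (\<Sum>a\<in>I. 1)"
      by (intro sum_mono)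
    then show ?thesis by (simp add: M_def)
  qed
  have "?E * ln (\<delta> * R) \<le> bin_avg \<delta> V (\<lambda>Z. \<Sum>a\<in>I. \<Sum>c\<in>I. q a c Z * real (j a c)) * ln (\<delta> * R)"
    using R t_avg by (intro mult_right_mono) (auto simp: bin_avg_sum intro!: sum_mono)
  also have "\<dots> = bin_avg \<delta> V (\<lambda>Z. \<Sum>a\<in>I. \<Sum>c\<in>I. q a c Z * (real (j a c) * ln (\<delta> * R)))"
    unfolding mult.commute[of "bin_avg _ _ _"] bin_avg_cmult[symmetric]
    by (simp add: sum_distrib_left mult_ac)
  also have "\<dots> \<le> bin_avg \<delta> V (\<lambda>Z. \<Sum>a\<in>I. \<Sum>c\<in>I. q a c Z * (ln 2 * real (card (X a))) +
      ((\<delta> * R) ^ j a c / (2 ^ card (X a) * M)) * (wt a Z * wt c Z) - q a c Z + (M * q a c Z / N Z - q a c Z))"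
    using \<delta> key by (intro bin_avg_mono sum_mono) auto
  also have "\<dots> = bin_avg \<delta> V (\<lambda>Z. (\<Sum>a\<in>I. (ln 2 * real (card (X a))) * wt a Z) +
      (\<Sum>a\<in>I. \<Sum>c\<in>I. ((\<delta> * R) ^ j a c / (2 ^ card (X a) * M)) * (wt a Z * wt c Z))
      - (\<Sum>a\<in>I. wt a Z) + ((if N Z = 0 then 0 else M) - (\<Sum>a\<in>I. wt a Z)))"
  proof (rule bin_avg_cong)
    fix Z
    have 1: "(\<Sum>a\<in>I. \<Sum>c\<in>I. q a c Z * (ln 2 * real (card (X a)))) =
        (\<Sum>a\<in>I. (ln 2 * real (card (X a))) * wt a Z)"
      by (intro sum.cong refl) (simp add: sum_q mult.commute flip: sum_distrib_right)
    have 2: "(\<Sum>a\<in>I. \<Sum>c\<in>I. q a c Z) = (\<Sum>a\<in>I. wt a Z)"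
      by (intro sum.cong refl) (simp add: sum_q)
    have 3: "(\<Sum>a\<in>I. \<Sum>c\<in>I. M * q a c Z / N Z) = (if N Z = 0 then 0 else M)"
    proof -
      have "(\<Sum>a\<in>I. \<Sum>c\<in>I. M * q a c Z / N Z) = M * (\<Sum>a\<in>I. \<Sum>c\<in>I. q a c Z) / N Z"
        by (simp add: sum_distrib_left sum_divide_distrib)
      also have "\<dots> = (if N Z = 0 then 0 else M)" unfolding 2 by (simp flip: N_def)
      finally show ?thesis .
    qed
    show "(\<Sum>a\<in>I. \<Sum>c\<in>I. q a c Z * (ln 2 * real (card (X a))) +
      ((\<delta> * R) ^ j a c / (2 ^ card (X a) * M)) * (wt a Z * wt c Z) - q a c Z + (M * q a c Z / N Z - q a c Z))
      = (\<Sum>a\<in>I. (ln 2 * real (card (X a))) * wt a Z) +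
      (\<Sum>a\<in>I. \<Sum>c\<in>I. ((\<delta> * R) ^ j a c / (2 ^ card (X a) * M)) * (wt a Z * wt c Z))
      - (\<Sum>a\<in>I. wt a Z) + ((if N Z = 0 then 0 else M) - (\<Sum>a\<in>I. wt a Z))"
      unfolding sum.distrib sum_subtractf 1 2 3 ..
  qed
  also have "\<dots> = ln 2 * (\<Sum>a\<in>I. real (card (X a))) +
      (\<Sum>a\<in>I. \<Sum>c\<in>I. (\<delta> * R) ^ j a c / (2 ^ card (X a) * M) * (1/\<delta>) ^ j a c)
      - M + (bin_avg \<delta> V (\<lambda>Z. if N Z = 0 then 0 else M) - M)"
    by (simp only: bin_avg_add bin_avg_diff bin_avg_sum bin_avg_cmult)
      (simp add: avg_wt avg_wt2 sum_distrib_left M_def)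
  also have "\<dots> \<le> ln 2 * (\<Sum>a\<in>I. real (card (X a))) + M - M + (M - M)"
  proof -
    have "bin_avg \<delta> V (\<lambda>Z. if N Z = 0 then 0 else M) \<le> bin_avg \<delta> V (\<lambda>_. M)"
      using \<delta> by (intro bin_avg_mono) (auto simp: M_def)
    then show ?thesis using main_sum bin_avg_const[OF finV, of \<delta> M] by linarith
  qed
  finally have "ln (\<delta> * R) * ?E \<le> ln 2 * (\<Sum>a\<in>I. real (card (X a)))" by (simp add: mult.commute)
  then show ?thesis using P_b unfolding P_def by (intro exI[of _ b] conjI) auto
qed

text \<open>After \<open>\<beta>\<close> rounds the expected total size of the fragments has shrunk by the factor \<open>c\<^sup>\<beta>\<close>, while a failure to find a
  member inside the random set means that every fragment still has at least one element.\<close>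

lemma spread_iterate:
  fixes X :: "'a \<Rightarrow> 'v set" and \<delta> R c :: real
  assumes "finite V" and finI: "finite I" and "\<And>a. a \<in> I \<Longrightarrow> X a \<subseteq> V"
    and \<delta>: "0 < \<delta>" "\<delta> \<le> 1" and R: "0 < R" "1 < \<delta> * R" and c: "ln 2 \<le> c * ln (\<delta> * R)"
    and "\<And>T. T \<subseteq> V \<Longrightarrow> R ^ card T * real (card {a \<in> I. T \<subseteq> X a}) \<le> real (card I)"
  shows "real (card I) * bin_avg (1 - (1 - \<delta>) ^ \<beta>) V (\<lambda>W. if \<exists>a\<in>I. X a \<subseteq> W then 0 else 1)
    \<le> c ^ \<beta> * (\<Sum>a\<in>I. real (card (X a)))"
  using assms(1,3,9)
proof (induction \<beta> arbitrary: V X)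
  case 0
  let ?g = "\<lambda>W. if \<exists>a\<in>I. X a \<subseteq> W then 0 else (1::real)"
  have "bin_avg 0 V ?g = ?g {}"
  proof -
    have "bin_avg 0 V ?g = (\<Sum>W\<in>Pow V. if W = {} then ?g {} else 0)"
      unfolding bin_avg_def
    proof (intro sum.cong refl)
      fix W assume "W \<in> Pow V"
      then have "finite W" using 0(1) finite_subset by blast
      then show "0 ^ card W * (1 - 0) ^ card (V - W) * ?g W = (if W = {} then ?g {} else 0)"
        by (cases "W = {}") (simp_all add: power_0_left)
    qed
    also have "\<dots> = ?g {}" using 0(1) by (subst sum.delta) auto
    finally show ?thesis .
  qed
  moreover have "real (card I) * ?g {} \<le> (\<Sum>a\<in>I. real (card (X a)))"
  proof (cases "\<exists>a\<in>I. X a \<subseteq> {}")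
    case False
    have "1 \<le> real (card (X a))" if "a \<in> I" for a
      using False that 0(2)[OF that] 0(1) finite_subset[of "X a" V]
      by (simp add: Suc_le_eq card_gt_0_iff)
    then have "(\<Sum>a\<in>I. 1) \<le> (\<Sum>a\<in>I. real (card (X a)))" by (intro sum_mono)
    then show ?thesis using False by simp
  qed (simp add: sum_nonneg)
  ultimately show ?case by simp
next
  case (Suc \<beta>)
  obtain b where b': "\<forall>W. \<forall>a\<in>I. b W a \<in> I \<and> X (b W a) \<subseteq> X a \<union> W"
    and frag: "ln (\<delta> * R) * bin_avg \<delta> V (\<lambda>W. \<Sum>a\<in>I. real (card (X (b W a) - W)))
      \<le> ln 2 * (\<Sum>a\<in>I. real (card (X a)))"
    using fragment_lemma[OF Suc.prems(1) finI Suc.prems(2) \<delta> R Suc.prems(3)] by blast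
  have b: "b W a \<in> I" "X (b W a) \<subseteq> X a \<union> W" if "a \<in> I" for W a
    using b' that by auto
  define Y where "Y W a = X (b W a) - W" for W a
  let ?fail = "\<lambda>X W. if \<exists>a\<in>I. X a \<subseteq> W then 0 else (1::real)"
  have lp: "0 < ln (\<delta> * R)" using R by simp
  have c0: "0 \<le> c"
  proof (rule ccontr)
    assume "\<not> 0 \<le> c"
    then have "c * ln (\<delta> * R) \<le> 0" using lp by (simp add: mult_nonpos_nonneg)
    moreover have "0 < ln (2::real)" by simp
    ultimately show False using c by linarith
  qed
  have eq: "1 - (1 - \<delta>) ^ Suc \<beta> = 1 - (1 - \<delta>) * (1 - (1 - (1 - \<delta>) ^ \<beta>))" by simp
  have pr: "0 \<le> 1 - (1 - \<delta>) ^ \<beta>" "1 - (1 - \<delta>) ^ \<beta> \<le> 1"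
    using \<delta> by (auto simp: power_le_one)
  have step: "real (card I) * bin_avg (1 - (1 - \<delta>) ^ \<beta>) (V - W) (\<lambda>W2. ?fail X (W \<union> W2))
      \<le> c ^ \<beta> * (\<Sum>a\<in>I. real (card (Y W a)))" if W: "W \<subseteq> V" for W
  proof -
    have "bin_avg (1 - (1 - \<delta>) ^ \<beta>) (V - W) (\<lambda>W2. ?fail X (W \<union> W2)) \<le>
        bin_avg (1 - (1 - \<delta>) ^ \<beta>) (V - W) (?fail (Y W))"
    proof (rule bin_avg_mono[OF pr])
      fix W2
      have "\<exists>a\<in>I. X a \<subseteq> W \<union> W2" if "\<exists>a\<in>I. Y W a \<subseteq> W2"
        using that b(1) unfolding Y_def by blast
      then show "?fail X (W \<union> W2) \<le> ?fail (Y W) W2" by auto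
    qed
    moreover have "real (card I) * bin_avg (1 - (1 - \<delta>) ^ \<beta>) (V - W) (?fail (Y W))
        \<le> c ^ \<beta> * (\<Sum>a\<in>I. real (card (Y W a)))"
    proof (rule Suc.IH)
      show "finite (V - W)" using Suc.prems(1) by simp
      show "Y W a \<subseteq> V - W" if "a \<in> I" for a
        using Suc.prems(2)[OF b(1)[OF that]] unfolding Y_def by blast
      fix T assume T: "T \<subseteq> V - W"
      have "Y W a \<subseteq> X a" if "a \<in> I" for a
        using b(2)[OF that] unfolding Y_def by blast
      then have "{a \<in> I. T \<subseteq> Y W a} \<subseteq> {a \<in> I. T \<subseteq> X a}" by blast
      then have "card {a \<in> I. T \<subseteq> Y W a} \<le> card {a \<in> I. T \<subseteq> X a}"
        using finI by (intro card_mono) auto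
      then have "R ^ card T * real (card {a \<in> I. T \<subseteq> Y W a}) \<le> R ^ card T * real (card {a \<in> I. T \<subseteq> X a})"
        using R by (intro mult_left_mono) auto
      also have "\<dots> \<le> real (card I)" using T by (intro Suc.prems(3)) auto
      finally show "R ^ card T * real (card {a \<in> I. T \<subseteq> Y W a}) \<le> real (card I)" .
    qed
    ultimately show ?thesis
      by (meson mult_left_mono of_nat_0_le_iff order_trans)
  qed
  have "real (card I) * bin_avg (1 - (1 - \<delta>) ^ Suc \<beta>) V (?fail X) =
      bin_avg \<delta> V (\<lambda>W. real (card I) * bin_avg (1 - (1 - \<delta>) ^ \<beta>) (V - W) (\<lambda>W2. ?fail X (W \<union> W2)))"
    unfolding eq bin_avg_two_step[OF Suc.prems(1)] bin_avg_cmult ..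
  also have "\<dots> \<le> bin_avg \<delta> V (\<lambda>W. c ^ \<beta> * (\<Sum>a\<in>I. real (card (Y W a))))"
    using \<delta> step by (intro bin_avg_mono) auto
  also have "\<dots> = c ^ \<beta> * bin_avg \<delta> V (\<lambda>W. \<Sum>a\<in>I. real (card (Y W a)))"
    by (rule bin_avg_cmult)
  also have "\<dots> \<le> c ^ \<beta> * (c * (\<Sum>a\<in>I. real (card (X a))))"
  proof (rule mult_left_mono)
    have "ln (\<delta> * R) * bin_avg \<delta> V (\<lambda>W. \<Sum>a\<in>I. real (card (Y W a))) \<le>
        (c * ln (\<delta> * R)) * (\<Sum>a\<in>I. real (card (X a)))"
      unfolding Y_def by (rule order_trans[OF frag mult_right_mono[OF c]]) (simp add: sum_nonneg)
    then show "bin_avg \<delta> V (\<lambda>W. \<Sum>a\<in>I. real (card (Y W a))) \<le> c * (\<Sum>a\<in>I. real (card (X a)))"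
      using lp by (simp add: mult_ac)
  qed (use c0 in simp)
  finally show ?case by (simp add: mult_ac)
qed

lemma sum_PiE_insert:
  assumes "x \<notin> S"
  shows "(\<Sum>f\<in>PiE (insert x S) T. g f) = (\<Sum>y\<in>T x. \<Sum>f\<in>PiE S T. g (f(x := y)))"
proof -
  have "(\<Sum>f\<in>PiE (insert x S) T. g f) = (\<Sum>(y,f)\<in>T x \<times> PiE S T. g (f(x := y)))"
    unfolding PiE_insert_eq
    by (subst sum.reindex[OF inj_combinator[OF assms]]) (auto simp: o_def case_prod_beta)
  then show ?thesis by (simp add: sum.cartesian_product)
qed

text \<open>A colour class of a uniformly random colouring is a binomial random set.\<close>

lemma sum_colouring_class:
  fixes g :: "'v set \<Rightarrow> real" and C :: "'c set"
  assumes "finite V" "finite C" "i \<in> C"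
  shows "(\<Sum>\<kappa>\<in>V \<rightarrow>\<^sub>E C. g {x\<in>V. \<kappa> x = i}) = real (card C) ^ card V * bin_avg (1 / card C) V g"
  using assms(1)
proof (induction V arbitrary: g rule: finite_induct)
  case empty
  then show ?case by simp
next
  case (insert v V)
  have C0: "0 < card C" using assms card_gt_0_iff by blast
  have inner: "(\<Sum>\<kappa>\<in>V \<rightarrow>\<^sub>E C. g {x \<in> insert v V. (\<kappa>(v := y)) x = i}) =
     (\<Sum>\<kappa>\<in>V \<rightarrow>\<^sub>E C. (if y = i then g (insert v {x\<in>V. \<kappa> x = i}) else g {x\<in>V. \<kappa> x = i}))" for y
  proof (rule sum.cong[OF refl])
    fix \<kappa>
    have "{x \<in> insert v V. (\<kappa>(v := y)) x = i} =
        (if y = i then insert v {x\<in>V. \<kappa> x = i} else {x\<in>V. \<kappa> x = i})"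
      using insert.hyps by auto
    then show "g {x \<in> insert v V. (\<kappa>(v := y)) x = i} =
      (if y = i then g (insert v {x\<in>V. \<kappa> x = i}) else g {x\<in>V. \<kappa> x = i})" by simp
  qed
  have "(\<Sum>\<kappa>\<in>insert v V \<rightarrow>\<^sub>E C. g {x\<in>insert v V. \<kappa> x = i}) =
    (\<Sum>y\<in>C. (if y = i then (\<Sum>\<kappa>\<in>V \<rightarrow>\<^sub>E C. g (insert v {x\<in>V. \<kappa> x = i}))
       else (\<Sum>\<kappa>\<in>V \<rightarrow>\<^sub>E C. g {x\<in>V. \<kappa> x = i})))"
    unfolding sum_PiE_insert[OF insert.hyps(2)] inner by (intro sum.cong refl) simp
  also have "\<dots> = (\<Sum>\<kappa>\<in>V \<rightarrow>\<^sub>E C. g (insert v {x\<in>V. \<kappa> x = i})) +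
      real (card C - 1) * (\<Sum>\<kappa>\<in>V \<rightarrow>\<^sub>E C. g {x\<in>V. \<kappa> x = i})"
  proof -
    have "(\<Sum>y\<in>C. if y = i then A else B) = A + real (card C - 1) * B" for A B :: real
    proof -
      have "(\<Sum>y\<in>C. if y = i then A else B) = A + (\<Sum>y\<in>C - {i}. if y = i then A else B)"
        by (rule trans[OF sum.remove[OF assms(2,3)]]) simp
      also have "(\<Sum>y\<in>C - {i}. if y = i then A else B) = (\<Sum>y\<in>C - {i}. B)"
        by (intro sum.cong) auto
      finally show ?thesis using assms(2,3) by simp
    qed
    then show ?thesis .
  qed
  also have "\<dots> = real (card C) ^ card V * bin_avg (1 / card C) V (\<lambda>W. g (insert v W)) +
      real (card C - 1) * (real (card C) ^ card V * bin_avg (1 / card C) V g)"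
    using insert.IH[of "\<lambda>W. g (insert v W)"] insert.IH[of g] by simp
  also have "\<dots> = real (card C) ^ card (insert v V) * bin_avg (1 / card C) (insert v V) g"
    unfolding bin_avg_insert[OF insert.hyps] using insert.hyps C0
    by (simp add: field_simps of_nat_diff)
  finally show ?case .
qed

text \<open>The spread lemma for several families at once. A single colour class is a random set of density
  \<open>1/s\<close>; it is split into \<open>\<beta> \<approx> log\<^sub>2 (sk)\<close> rounds of equal density, each of
  which shrinks the fragments by a factor of at least \<open>3\<close>. So a family fails with probability at most
  \<open>3\<^sup>-\<^sup>\<beta> k < 1/s\<close>, and a union bound over the \<open>s\<close> families finishes the argument.\<close>

theorem disjoint_members_of_spread_families:
  fixes X :: "nat \<Rightarrow> 'a \<Rightarrow> 'v set" and I :: "nat \<Rightarrow> 'a set" and R :: real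
  assumes finV: "finite V" and s: "2 \<le> s" and k: "1 \<le> k"
    and I: "\<And>i. i \<in> {1..s} \<Longrightarrow> finite (I i)" "\<And>i. i \<in> {1..s} \<Longrightarrow> I i \<noteq> {}"
    and X: "\<And>i a. i \<in> {1..s} \<Longrightarrow> a \<in> I i \<Longrightarrow> X i a \<subseteq> V"
      "\<And>i a. i \<in> {1..s} \<Longrightarrow> a \<in> I i \<Longrightarrow> card (X i a) \<le> k"
    and R: "16 * real s * log 2 (real s * real k) \<le> R"
    and spread: "\<And>i T. i \<in> {1..s} \<Longrightarrow> T \<subseteq> V \<Longrightarrow>
      R ^ card T * real (card {a \<in> I i. T \<subseteq> X i a}) \<le> real (card (I i))"
  shows "\<exists>a. (\<forall>i\<in>{1..s}. a i \<in> I i) \<and>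
    (\<forall>i\<in>{1..s}. \<forall>j\<in>{1..s}. i \<noteq> j \<longrightarrow> X i (a i) \<inter> X j (a j) = {})"
proof -
  define l where "l = log 2 (real s * real k)"
  define \<beta> where "\<beta> = nat \<lceil>l\<rceil>"
  \<comment> \<open>chosen so that \<open>\<beta>\<close> rounds of density \<open>\<delta>\<close> have total density exactly \<open>1/s\<close>\<close>
  define \<delta> where "\<delta> = 1 - root \<beta> (1 - 1 / real s)"
  have sk: "2 \<le> real s * real k"
    using s k mult_mono[of 2 "real s" 1 "real k"] by simp
  have l1: "1 \<le> l"
    unfolding l_def using sk by (simp add: le_log_iff)
  \<comment> \<open>rounding up at most doubles \<open>l \<ge> 1\<close>, so \<open>\<delta> R\<close> is at least \<open>8\<close> rather than \<open>16\<close>\<close>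
  have \<beta>l: "l \<le> real \<beta>" "real \<beta> \<le> 2 * l" "0 < \<beta>"
    unfolding \<beta>_def using l1 by linarith+
  have pow\<beta>: "real s * real k \<le> 2 ^ \<beta>"
  proof -
    have "real s * real k = 2 powr l" unfolding l_def using sk by simp
    also have "\<dots> \<le> 2 powr real \<beta>" using \<beta>l by simp
    finally show ?thesis by (simp add: powr_realpow)
  qed
  have "1 - 1 / real s \<le> (1 - 1 / (real s * real \<beta>)) ^ \<beta>"
  proof -
    have "1 \<le> real s * real \<beta>" using s \<beta>l mult_mono[of 1 "real s" 1 "real \<beta>"] by simp
    then have "1 / (real s * real \<beta>) \<le> 1" by simp
    then have "1 + real \<beta> * (- (1 / (real s * real \<beta>))) \<le> (1 + - (1 / (real s * real \<beta>))) ^ \<beta>"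
      by (intro Bernoulli_inequality) linarith
    then show ?thesis using \<beta>l by simp
  qed
  then have "root \<beta> (1 - 1 / real s) \<le> root \<beta> ((1 - 1 / (real s * real \<beta>)) ^ \<beta>)"
    using \<beta>l by simp
  also have "\<dots> = 1 - 1 / (real s * real \<beta>)"
  proof (rule real_root_power_cancel[OF \<beta>l(3)])
    have "1 \<le> real s * real \<beta>" using s \<beta>l mult_mono[of 1 "real s" 1 "real \<beta>"] by simp
    then show "0 \<le> 1 - 1 / (real s * real \<beta>)" by simp
  qed
  finally have \<delta>_ge: "1 / (real s * real \<beta>) \<le> \<delta>" unfolding \<delta>_def by simp
  have \<delta>: "0 < \<delta>" "\<delta> \<le> 1"
  proof -
    have "0 < 1 / (real s * real \<beta>)" using s \<beta>l by simp
    then show "0 < \<delta>" using \<delta>_ge by linarith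
    show "\<delta> \<le> 1" unfolding \<delta>_def using s \<beta>l by simp
  qed
  have p: "1 - (1 - \<delta>) ^ \<beta> = 1 / real s"
    unfolding \<delta>_def using s \<beta>l by simp
  have R16: "16 * real s * l \<le> R" using R unfolding l_def .
  have "0 < 16 * real s * l" using s l1 by simp
  then have Rp: "0 < R" using R16 by linarith
  have \<delta>R: "8 \<le> \<delta> * R"
  proof -
    have "8 \<le> 16 * l / real \<beta>" using \<beta>l by (simp add: field_simps)
    also have "\<dots> = (1 / (real s * real \<beta>)) * (16 * real s * l)" using s by simp
    also have "\<dots> \<le> \<delta> * R"
      using \<delta>_ge R16 \<delta> l1 by (intro mult_mono) auto
    finally show ?thesis .
  qed
  have ln8: "ln 2 \<le> (1/3) * ln (\<delta> * R)"
  proof -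
    have "3 * ln 2 = ln ((2::real) ^ 3)" by (subst ln_realpow) auto
    also have "\<dots> \<le> ln (\<delta> * R)" using \<delta>R by simp
    finally show ?thesis by simp
  qed
  let ?fail = "\<lambda>i W. if \<exists>a\<in>I i. X i a \<subseteq> W then 0 else (1::real)"
  have fail: "bin_avg (1 / real s) V (?fail i) < 1 / real s" if i: "i \<in> {1..s}" for i
  proof -
    have M: "0 < real (card (I i))" using I[OF i] by (simp add: card_gt_0_iff)
    have "real (card (I i)) * bin_avg (1 / real s) V (?fail i) \<le>
        (1/3) ^ \<beta> * (\<Sum>a\<in>I i. real (card (X i a)))"
      using spread_iterate[OF finV I(1)[OF i] X(1)[OF i] \<delta> Rp _ ln8 spread[OF i], of \<beta>] \<delta>R
      unfolding p by simp
    also have "\<dots> \<le> (1/3) ^ \<beta> * (\<Sum>a\<in>I i. real k)"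
      using X(2)[OF i] by (intro mult_left_mono sum_mono) auto
    also have "\<dots> = real (card (I i)) * ((1/3) ^ \<beta> * real k)" by simp
    finally have "bin_avg (1 / real s) V (?fail i) \<le> (1/3) ^ \<beta> * real k"
      using M by simp
    also have "\<dots> < (1/2) ^ \<beta> * real k"
      using k \<beta>l by (intro mult_strict_right_mono power_strict_mono) auto
    also have "\<dots> \<le> 1 / real s"
      using pow\<beta> s k by (simp add: field_simps)
    finally show ?thesis .
  qed
  have "(\<Sum>\<kappa>\<in>V \<rightarrow>\<^sub>E {1..s}. \<Sum>i\<in>{1..s}. ?fail i {x\<in>V. \<kappa> x = i}) =
      (\<Sum>i\<in>{1..s}. real s ^ card V * bin_avg (1 / real s) V (?fail i))"
    by (subst sum.swap, intro sum.cong refl, subst sum_colouring_class[OF finV]) auto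
  also have "\<dots> < (\<Sum>i\<in>{1..s}. real s ^ card V * (1 / real s))"
    using s fail by (intro sum_strict_mono mult_strict_left_mono) auto
  also have "\<dots> = (\<Sum>\<kappa>\<in>V \<rightarrow>\<^sub>E {1..s}. 1)"
    using s finV by (simp add: card_PiE)
  finally have "\<exists>\<kappa>\<in>V \<rightarrow>\<^sub>E {1..s}. (\<Sum>i\<in>{1..s}. ?fail i {x\<in>V. \<kappa> x = i}) < 1"
    by (meson not_le sum_mono)
  then obtain \<kappa> where \<kappa>: "(\<Sum>i\<in>{1..s}. ?fail i {x\<in>V. \<kappa> x = i}) < 1" by blast
  have "\<exists>a\<in>I i. X i a \<subseteq> {x\<in>V. \<kappa> x = i}" if i: "i \<in> {1..s}" for i
  proof (rule ccontr)
    assume "\<not> ?thesis"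
    then have "1 = ?fail i {x\<in>V. \<kappa> x = i}" by simp
    also have "\<dots> \<le> (\<Sum>i\<in>{1..s}. ?fail i {x\<in>V. \<kappa> x = i})"
      using i by (intro member_le_sum) auto
    finally show False using \<kappa> by simp
  qed
  then obtain a where "\<And>i. i \<in> {1..s} \<Longrightarrow> a i \<in> I i \<and> X i (a i) \<subseteq> {x\<in>V. \<kappa> x = i}"
    by metis
  then show ?thesis by (intro exI[of _ a]) blast
qed

section \<open>Spread cores of families of tuples\<close>

text \<open>Passing to graphs turns disjointness of tuples into disjointness of sets and partial tuples into subsets.\<close>

definition gr :: "nat \<Rightarrow> (nat \<Rightarrow> nat) \<Rightarrow> (nat \<times> nat) set" where
  "gr k x = (\<lambda>i. (i, x i)) ` {1..k}"

lemma mem_gr: "(i, v) \<in> gr k x \<longleftrightarrow> i \<in> {1..k} \<and> x i = v"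
  by (auto simp: gr_def)

lemma finite_gr [simp]: "finite (gr k x)"
  by (simp add: gr_def)

lemma card_gr [simp]: "card (gr k x) = k"
  unfolding gr_def by (subst card_image) (auto simp: inj_on_def)

lemma gr_subset: "x \<in> tuples n k \<Longrightarrow> gr k x \<subseteq> {1..k} \<times> {1..n}"
  by (auto simp: gr_def tuples_def PiE_iff)

lemma disjoint_tuples_gr: "disjoint_tuples k x y \<longleftrightarrow> gr k x \<inter> gr k y = {}"
  by (auto simp: disjoint_tuples_def gr_def)

lemma finite_tuples [simp]: "finite (tuples n k)"
  unfolding tuples_def by (intro finite_PiE) auto

lemma card_tuples_containing:
  assumes "S \<subseteq> gr k x0"
  shows "card {x \<in> tuples n k. S \<subseteq> gr k x} \<le> n ^ (k - card S)"
proof -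
  have "inj_on fst (gr k x0)" by (auto simp: gr_def inj_on_def)
  then have inj: "inj_on fst S" using assms by (rule inj_on_subset)
  have finS: "finite S" using assms finite_gr by (rule finite_subset)
  have S: "fst ` S \<subseteq> {1..k}" using assms by (auto simp: gr_def)
  let ?D = "{1..k} - fst ` S"
  have "inj_on (\<lambda>x. restrict x ?D) {x \<in> tuples n k. S \<subseteq> gr k x}"
  proof (rule inj_onI)
    fix x y assume x: "x \<in> {x \<in> tuples n k. S \<subseteq> gr k x}" and y: "y \<in> {x \<in> tuples n k. S \<subseteq> gr k x}"
      and e: "restrict x ?D = restrict y ?D"
    show "x = y"
    proof
      fix i
      consider "i \<notin> {1..k}" | "i \<in> ?D" | "i \<in> fst ` S" by blast
      then show "x i = y i"
      proof cases
        case 1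
        then show ?thesis using x y by (auto simp: tuples_def PiE_iff extensional_def)
      next
        case 2
        then show ?thesis using fun_cong[OF e, of i] by simp
      next
        case 3
        then obtain v where "(i, v) \<in> S" by auto
        then show ?thesis using x y by (auto simp: gr_def)
      qed
    qed
  qed
  moreover have "(\<lambda>x. restrict x ?D) ` {x \<in> tuples n k. S \<subseteq> gr k x} \<subseteq> ?D \<rightarrow>\<^sub>E {1..n}"
  proof (intro image_subsetI)
    fix x assume "x \<in> {x \<in> tuples n k. S \<subseteq> gr k x}"
    then have "\<forall>i\<in>{1..k}. x i \<in> {1..n}" unfolding tuples_def PiE_iff by blast
    then show "restrict x ?D \<in> ?D \<rightarrow>\<^sub>E {1..n}" by (simp only: restrict_PiE_iff) blast
  qed
  ultimately have "card {x \<in> tuples n k. S \<subseteq> gr k x} \<le> card (?D \<rightarrow>\<^sub>E {1..n})"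
    by (intro card_inj_on_le[where f = "\<lambda>x. restrict x ?D"] finite_PiE) auto
  also have "\<dots> = n ^ card ?D" by (simp add: card_PiE)
  also have "card ?D = k - card S"
    using S finS inj by (subst card_Diff_subset) (simp_all add: card_image)
  finally show ?thesis .
qed

text \<open>The set \<open>T\<close> may be infinite or may fail to be a partial tuple: then no member of \<open>G\<close> contains it and the
  condition is void.\<close>

definition spread_core :: "real \<Rightarrow> nat \<Rightarrow> (nat \<Rightarrow> nat) set \<Rightarrow> (nat \<times> nat) set \<Rightarrow> bool" where
  "spread_core R k F S \<longleftrightarrow> (\<exists>G\<subseteq>F. G \<noteq> {} \<and> (\<forall>x\<in>G. S \<subseteq> gr k x) \<and>
     (\<forall>T. T \<inter> S = {} \<longrightarrow> R ^ card T * real (card {x\<in>G. T \<subseteq> gr k x}) \<le> real (card G)))"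

lemma spread_core_finite: "spread_core R k F S \<Longrightarrow> finite S"
  unfolding spread_core_def using finite_subset[OF _ finite_gr] by blast

text \<open>Let \<open>F'\<close> be the family of tuples above no small core, and take a largest set \<open>S\<close> that is contained in at
  least a fraction \<open>R\<^sup>-\<^sup>|\<^sup>S\<^sup>|\<close> of \<open>F'\<close>. By maximality \<open>S\<close> is a core; as it lies below tuples of \<open>F'\<close>, it has more
  than \<open>q\<close> vertices. And at most \<open>n\<^sup>k\<^sup>-\<^sup>|\<^sup>S\<^sup>|\<close> tuples contain \<open>S\<close>, which bounds \<open>F'\<close> because \<open>R \<le> n\<close>.\<close>

lemma card_uncovered_by_cores:
  assumes F: "F \<subseteq> tuples n k" and R: "1 \<le> R" "R \<le> real n"
  shows "real (card {x\<in>F. \<not> (\<exists>S. card S \<le> q \<and> S \<subseteq> gr k x \<and> spread_core R k F S)})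
    \<le> R ^ Suc q * real n powr (real k - real (Suc q))"
proof -
  define F' where "F' = {x\<in>F. \<not> (\<exists>S. card S \<le> q \<and> S \<subseteq> gr k x \<and> spread_core R k F S)}"
  define V where "V = {1..k} \<times> {1..n}"
  have F'F: "F' \<subseteq> F" "F' \<subseteq> tuples n k" using F by (auto simp: F'_def)
  have finF': "finite F'" using F'F finite_subset finite_tuples by blast
  show ?thesis
  proof (cases "F' = {}")
    case True
    then show ?thesis using R unfolding F'_def[symmetric] by simp
  next
    case False
    then have F'p: "0 < card F'" using finF' by (simp add: card_gt_0_iff)
    define heavy where "heavy S \<longleftrightarrow> S \<subseteq> V \<and> real (card F') \<le> R ^ card S * real (card {x\<in>F'. S \<subseteq> gr k x})" for S
    have h0: "heavy {}" by (simp add: heavy_def)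
    have "finite V" by (simp add: V_def)
    then have "\<forall>S. heavy S \<longrightarrow> card S < Suc (card V)"
      unfolding heavy_def by (auto simp: less_Suc_eq_le intro: card_mono)
    then obtain S where S: "heavy S" and Smax: "\<And>T. heavy T \<Longrightarrow> card T \<le> card S"
      using ex_has_greatest_nat[of heavy "{}" card "Suc (card V)"] h0 by blast
    define G where "G = {x\<in>F'. S \<subseteq> gr k x}"
    have finS: "finite S" using S unfolding heavy_def V_def by (meson finite_SigmaI finite_atLeastAtMost finite_subset)
    have G_ge: "real (card F') \<le> R ^ card S * real (card G)"
      using S by (simp add: heavy_def G_def)
    have Gne: "G \<noteq> {}" using G_ge F'p by auto
    have spr: "R ^ card T * real (card {x\<in>G. T \<subseteq> gr k x}) \<le> real (card G)" if T: "T \<inter> S = {}" for T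
    proof (cases "T = {} \<or> {x\<in>G. T \<subseteq> gr k x} = {}")
      case True
      then show ?thesis
      proof
        assume e: "{x\<in>G. T \<subseteq> gr k x} = {}"
        show ?thesis unfolding e by simp
      qed simp
    next
      case False
      then obtain x where x: "x \<in> G" "T \<subseteq> gr k x" and Tne: "T \<noteq> {}" by auto
      then have TV: "T \<subseteq> V"
        using gr_subset[of x n k] F'F unfolding G_def V_def by blast
      have finT: "finite T" using x(2) finite_subset finite_gr by blast
      have cST: "card (S \<union> T) = card S + card T"
        using T finS finT by (intro card_Un_disjoint) auto
      have "card S < card (S \<union> T)"
        using cST Tne finT by (simp add: card_gt_0_iff)
      then have "\<not> heavy (S \<union> T)" using Smax[of "S \<union> T"] by auto
      moreover have "S \<union> T \<subseteq> V" using S TV by (simp add: heavy_def)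
      ultimately have "R ^ (card S + card T) * real (card {x\<in>F'. S \<union> T \<subseteq> gr k x}) < real (card F')"
        unfolding heavy_def cST by simp
      also note G_ge
      also have "{x\<in>F'. S \<union> T \<subseteq> gr k x} = {x\<in>G. T \<subseteq> gr k x}" by (auto simp: G_def)
      finally have "R ^ card S * (R ^ card T * real (card {x\<in>G. T \<subseteq> gr k x})) < R ^ card S * real (card G)"
        by (simp add: power_add mult_ac)
      moreover have "0 < R ^ card S" using R by simp
      ultimately show ?thesis by (simp add: less_imp_le)
    qed
    have core: "spread_core R k F S"
      unfolding spread_core_def using Gne spr F'F by (intro exI[of _ G]) (auto simp: G_def)
    obtain x where x: "x \<in> G" using Gne by auto
    then have xF': "x \<in> F'" and xS: "S \<subseteq> gr k x" by (auto simp: G_def)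
    have q: "Suc q \<le> card S"
    proof (rule ccontr)
      assume "\<not> ?thesis"
      then have "card S \<le> q" by simp
      then show False using xF' xS core unfolding F'_def by blast
    qed
    have Sk: "card S \<le> k" using card_mono[OF finite_gr xS] by simp
    have "card G \<le> card {x \<in> tuples n k. S \<subseteq> gr k x}"
      using F'F by (intro card_mono) (auto simp: G_def)
    also have "\<dots> \<le> n ^ (k - card S)" by (rule card_tuples_containing[OF xS])
    finally have Gn: "real (card G) \<le> real n ^ (k - card S)" by (metis of_nat_le_iff of_nat_power)
    have "real (card F') \<le> R ^ card S * real n ^ (k - card S)"
      by (rule order_trans[OF G_ge mult_left_mono[OF Gn]]) (use R in simp)
    also have "R ^ card S = R ^ Suc q * R ^ (card S - Suc q)"
      using q by (simp only: power_add[symmetric]) simp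
    also have "\<dots> * real n ^ (k - card S) \<le> R ^ Suc q * real n ^ (card S - Suc q) * real n ^ (k - card S)"
      using R by (intro mult_right_mono mult_left_mono power_mono) auto
    also have "\<dots> = R ^ Suc q * real n ^ (k - Suc q)"
      using q Sk by (simp add: mult.assoc power_add[symmetric])
    also have "real n ^ (k - Suc q) = real n powr (real k - real (Suc q))"
    proof -
      have "0 < real n" using R by linarith
      then show ?thesis using q Sk by (simp add: of_nat_diff flip: powr_realpow)
    qed
    finally show ?thesis unfolding F'_def .
  qed
qed

text \<open>From each subfamily \<open>G i\<close> one discards the tuples that meet another core. By spreadness these are at
  most half of \<open>G i\<close>, so what remains is still spread with constant \<open>R/2\<close>, and disjoint
  members outside the cores give disjoint tuples.\<close>

lemma rainbow_matching_of_cores: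
  assumes s: "2 \<le> s" and k: "1 \<le> k" and R: "32 * real s * log 2 (real s * real k) \<le> R"
    and F: "\<And>i. i \<in> {1..s} \<Longrightarrow> F i \<subseteq> tuples n k"
    and core: "\<And>i. i \<in> {1..s} \<Longrightarrow> spread_core R k (F i) (S i)"
    and S2: "\<And>i. i \<in> {1..s} \<Longrightarrow> card (S i) \<le> 2"
    and Sdisj: "\<And>i j. i \<in> {1..s} \<Longrightarrow> j \<in> {1..s} \<Longrightarrow> i \<noteq> j \<Longrightarrow> S i \<inter> S j = {}"
  shows "\<exists>x. rainbow_matching s k F x"
proof -
  have sk: "2 \<le> real s * real k"
    using s k mult_mono[of 2 "real s" 1 "real k"] by simp
  have "1 \<le> log 2 (real s * real k)" using sk by (simp add: le_log_iff)
  then have "32 * real s * 1 \<le> 32 * real s * log 2 (real s * real k)"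
    by (intro mult_left_mono) auto
  then have R32: "32 * real s \<le> R" using R by linarith
  then have Rp: "0 < R" using s by linarith
  have "\<forall>i\<in>{1..s}. \<exists>G. G \<subseteq> F i \<and> G \<noteq> {} \<and> (\<forall>x\<in>G. S i \<subseteq> gr k x) \<and>
     (\<forall>T. T \<inter> S i = {} \<longrightarrow> R ^ card T * real (card {x\<in>G. T \<subseteq> gr k x}) \<le> real (card G))"
    using core unfolding spread_core_def by blast
  from bchoice[OF this] obtain G where G: "\<forall>i\<in>{1..s}. G i \<subseteq> F i \<and> G i \<noteq> {} \<and> (\<forall>x\<in>G i. S i \<subseteq> gr k x) \<and>
     (\<forall>T. T \<inter> S i = {} \<longrightarrow> R ^ card T * real (card {x\<in>G i. T \<subseteq> gr k x}) \<le> real (card (G i)))"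
    by blast
  have GF: "G i \<subseteq> F i" "G i \<noteq> {}" if "i \<in> {1..s}" for i
    using G that by blast+
  have finG: "finite (G i)" if "i \<in> {1..s}" for i
    by (rule finite_subset[OF subset_trans[OF GF(1)[OF that] F[OF that]] finite_tuples])
  have Gspread: "R ^ card T * real (card {x\<in>G i. T \<subseteq> gr k x}) \<le> real (card (G i))"
    if "i \<in> {1..s}" "T \<inter> S i = {}" for i T
    using G that by blast
  have finS: "finite (S i)" if "i \<in> {1..s}" for i
    using spread_core_finite[OF core[OF that]] .
  define B where "B i = (\<Union>j\<in>{1..s} - {i}. S j)" for i
  define H where "H i = {x \<in> G i. gr k x \<inter> B i = {}}" for i
  have H_large: "real (card (G i)) \<le> 2 * real (card (H i))" if i: "i \<in> {1..s}" for i
  proof -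
    have finB: "finite (B i)" unfolding B_def using finS by auto
    have "card (B i) \<le> (\<Sum>j\<in>{1..s} - {i}. card (S j))"
      unfolding B_def by (intro card_UN_le) auto
    also have "\<dots> \<le> (\<Sum>j\<in>{1..s} - {i}. 2)" using S2 by (intro sum_mono) auto
    also have "\<dots> \<le> 2 * s" using i by simp
    finally have cB: "card (B i) \<le> 2 * s" .
    have one: "R * real (card {x\<in>G i. b \<in> gr k x}) \<le> real (card (G i))" if "b \<in> B i" for b
    proof -
      have "{b} \<inter> S i = {}" using that Sdisj i unfolding B_def by blast
      from Gspread[OF i this] show ?thesis by simp
    qed
    have "G i - H i = (\<Union>b\<in>B i. {x\<in>G i. b \<in> gr k x})" by (auto simp: H_def)
    then have "card (G i - H i) \<le> (\<Sum>b\<in>B i. card {x\<in>G i. b \<in> gr k x})"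
      using card_UN_le[OF finB] by simp
    then have "R * real (card (G i - H i)) \<le> (\<Sum>b\<in>B i. R * real (card {x\<in>G i. b \<in> gr k x}))"
      using Rp by (simp flip: sum_distrib_left of_nat_sum)
    also have "\<dots> \<le> (\<Sum>b\<in>B i. real (card (G i)))" by (intro sum_mono one)
    also have "\<dots> = real (card (B i)) * real (card (G i))" by simp
    also have "\<dots> \<le> (2 * real s) * real (card (G i))" using cB by (intro mult_right_mono) auto
    finally have a: "R * real (card (G i - H i)) \<le> (2 * real s) * real (card (G i))" .
    have "32 * real s * real (card (G i - H i)) \<le> R * real (card (G i - H i))"
      using R32 by (intro mult_right_mono) auto
    with a have "real s * (16 * real (card (G i - H i))) \<le> real s * real (card (G i))" by simp
    then have "16 * real (card (G i - H i)) \<le> real (card (G i))" using s by simp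
    moreover have "card (G i - H i) = card (G i) - card (H i)" "card (H i) \<le> card (G i)"
    proof -
      have "H i \<subseteq> G i" by (auto simp: H_def)
      then show "card (G i - H i) = card (G i) - card (H i)" "card (H i) \<le> card (G i)"
        using finG[OF i] by (simp_all add: card_Diff_subset card_mono finite_subset)
    qed
    ultimately show ?thesis by (simp add: of_nat_diff)
  qed
  define V where "V = {1..k} \<times> {1..n}"
  have "\<exists>x. (\<forall>i\<in>{1..s}. x i \<in> H i) \<and>
    (\<forall>i\<in>{1..s}. \<forall>j\<in>{1..s}. i \<noteq> j \<longrightarrow> (gr k (x i) - S i) \<inter> (gr k (x j) - S j) = {})"
  proof (rule disjoint_members_of_spread_families[of V s k H "\<lambda>i x. gr k x - S i" "R / 2"])
    show "finite V" by (simp add: V_def)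
    show "2 \<le> s" "1 \<le> k" by fact+
    fix i assume i: "i \<in> {1..s}"
    show "finite (H i)" using finG[OF i] by (simp add: H_def)
    show "H i \<noteq> {}"
    proof
      assume "H i = {}"
      then have "card (G i) = 0" using H_large[OF i] by simp
      then show False using GF(2)[OF i] finG[OF i] by simp
    qed
    show "gr k a - S i \<subseteq> V" if "a \<in> H i" for a
      using gr_subset[of a n k] that GF(1)[OF i] F[OF i] unfolding H_def V_def by blast
    show "card (gr k a - S i) \<le> k" if "a \<in> H i" for a
      using card_mono[OF finite_gr Diff_subset, of k a "S i"] by simp
    fix T :: "(nat \<times> nat) set"
    let ?c = "\<lambda>A. real (card {a \<in> A. T \<subseteq> gr k a - S i})"
    show "(R / 2) ^ card T * ?c (H i) \<le> real (card (H i))" if "T \<subseteq> V"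
    proof (cases "T = {} \<or> T \<inter> S i \<noteq> {}")
      case True
      then show ?thesis
      proof
        assume "T \<inter> S i \<noteq> {}"
        then have e: "{a \<in> H i. T \<subseteq> gr k a - S i} = {}" by blast
        show ?thesis unfolding e by simp
      qed simp
    next
      case False
      have "finite T" using that by (rule finite_subset) (simp add: V_def)
      then have "0 < card T" using False by (simp add: card_gt_0_iff)
      then have half: "(1/2::real) ^ card T \<le> 1/2"
        using power_decreasing[of 1 "card T" "1/2::real"] by simp
      have "(R / 2) ^ card T * ?c (H i) = (1/2) ^ card T * (R ^ card T * ?c (H i))"
        by (simp add: power_divide)
      also have "\<dots> \<le> (1/2) ^ card T * (R ^ card T * real (card {a \<in> G i. T \<subseteq> gr k a}))"
      proof -
        have "card {a \<in> H i. T \<subseteq> gr k a - S i} \<le> card {a \<in> G i. T \<subseteq> gr k a}"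
          using finG[OF i] by (intro card_mono) (auto simp: H_def)
        then show ?thesis using Rp by (intro mult_left_mono) auto
      qed
      also have "\<dots> \<le> (1/2) * real (card (G i))"
        using False Gspread[OF i, of T] half Rp by (intro mult_mono) auto
      also have "\<dots> \<le> real (card (H i))" using H_large[OF i] by simp
      finally show ?thesis .
    qed
  next
    show "16 * real s * log 2 (real s * real k) \<le> R / 2" using R by simp
  qed
  then obtain x where x: "\<And>i. i \<in> {1..s} \<Longrightarrow> x i \<in> H i"
    and xd: "\<And>i j. i \<in> {1..s} \<Longrightarrow> j \<in> {1..s} \<Longrightarrow> i \<noteq> j \<Longrightarrow> (gr k (x i) - S i) \<inter> (gr k (x j) - S j) = {}"
    by blast
  have "rainbow_matching s k F x"
    unfolding rainbow_matching_def pairwise_def disjoint_tuples_gr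
  proof (intro conjI ballI impI)
    show "x i \<in> F i" if "i \<in> {1..s}" for i
      using x[OF that] GF(1)[OF that] by (auto simp: H_def)
    fix i j assume ij: "i \<in> {1..s}" "j \<in> {1..s}" "i \<noteq> j"
    have "gr k (x i) \<inter> S j = {}" "gr k (x j) \<inter> S i = {}"
      using x[OF ij(1)] x[OF ij(2)] ij unfolding H_def B_def by blast+
    then show "gr k (x i) \<inter> gr k (x j) = {}" using xd[OF ij] by blast
  qed
  then show ?thesis by blast
qed

section \<open>Robust sets\<close>

text \<open>\<open>S\<close> is robust if it may stand for some member of \<open>\<S>\<close> that will be chosen later: whatever
  \<open>m\<close> vertices outside \<open>S\<close> are occupied by then, a member of \<open>\<S>\<close> remains available. The empty set is robust if
  \<open>\<S>\<close> has no cover by \<open>m\<close> vertices; a vertex of more than \<open>m\<close> pairs in \<open>\<S>\<close> is robust.\<close>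

definition robust :: "nat \<Rightarrow> 'v set set \<Rightarrow> 'v set \<Rightarrow> bool" where
  "robust m \<S> S \<longleftrightarrow> (\<forall>B. finite B \<and> card B \<le> m \<and> B \<inter> S = {} \<longrightarrow> (\<exists>S'\<in>\<S>. S' \<inter> B = {}))"

lemma robust_mem: "S \<in> \<S> \<Longrightarrow> robust m \<S> S"
  by (auto simp: robust_def)

text \<open>The sets are replaced one at a time. At each moment the other \<open>card A - 1\<close> sets, replaced or not, occupy at
  most \<open>m\<close> vertices and are disjoint from the set to be replaced, so robustness applies.\<close>

lemma replace_robust_by_members:
  assumes fin: "finite A" and m: "q * (card A - 1) \<le> m"
    and \<S>: "\<And>i S. i \<in> A \<Longrightarrow> S \<in> \<S> i \<Longrightarrow> finite S \<and> card S \<le> q"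
    and K: "\<And>i. i \<in> A \<Longrightarrow> finite (K i) \<and> card (K i) \<le> q \<and> robust m (\<S> i) (K i)"
    and disj: "\<And>i j. i \<in> A \<Longrightarrow> j \<in> A \<Longrightarrow> i \<noteq> j \<Longrightarrow> K i \<inter> K j = {}"
  shows "\<exists>S. (\<forall>i\<in>A. S i \<in> \<S> i) \<and> (\<forall>i\<in>A. \<forall>j\<in>A. i \<noteq> j \<longrightarrow> S i \<inter> S j = {})"
proof -
  have "\<exists>S. (\<forall>i\<in>A. (if i \<in> J then S i \<in> \<S> i else S i = K i)) \<and>
     (\<forall>i\<in>A. \<forall>j\<in>A. i \<noteq> j \<longrightarrow> S i \<inter> S j = {})" if "finite J" "J \<subseteq> A" for J
    using that
  proof (induction J rule: finite_induct)
    case empty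
    then show ?case using disj by (intro exI[of _ K]) auto
  next
    case (insert a J)
    then obtain S where S: "\<forall>i\<in>A. (if i \<in> J then S i \<in> \<S> i else S i = K i)"
      and Sd: "\<forall>i\<in>A. \<forall>j\<in>A. i \<noteq> j \<longrightarrow> S i \<inter> S j = {}" by auto
    have aA: "a \<in> A" using insert.prems by simp
    have small: "finite (S i) \<and> card (S i) \<le> q" if "i \<in> A" for i
      using S \<S>[OF that, of "S i"] K[OF that] that by (cases "i \<in> J") auto
    define B where "B = (\<Union>i\<in>A - {a}. S i)"
    have "finite B" unfolding B_def using fin small by auto
    moreover have "card B \<le> m"
    proof -
      have "card B \<le> (\<Sum>i\<in>A - {a}. card (S i))"
        unfolding B_def using fin by (intro card_UN_le) auto
      also have "\<dots> \<le> (\<Sum>i\<in>A - {a}. q)" using small by (intro sum_mono) auto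
      also have "\<dots> \<le> m" using m fin aA by (simp add: mult.commute)
      finally show ?thesis .
    qed
    moreover have "B \<inter> K a = {}"
    proof -
      have "S a = K a" using S aA insert.hyps by auto
      then show ?thesis using Sd aA unfolding B_def by blast
    qed
    ultimately obtain S' where S': "S' \<in> \<S> a" "S' \<inter> B = {}"
      using K[OF aA] unfolding robust_def by blast
    show ?case
    proof (intro exI[of _ "S(a := S')"] conjI)
      show "\<forall>i\<in>A. (if i \<in> insert a J then (S(a := S')) i \<in> \<S> i else (S(a := S')) i = K i)"
        using S S' by auto
      have *: "S' \<inter> S i = {}" if "i \<in> A" "i \<noteq> a" for i
        using S'(2) that unfolding B_def by blast
      show "\<forall>i\<in>A. \<forall>j\<in>A. i \<noteq> j \<longrightarrow> (S(a := S')) i \<inter> (S(a := S')) j = {}"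
        using Sd * by (auto simp: Int_commute)
    qed
  qed
  from this[OF fin order.refl] show ?thesis by auto
qed

lemma robust_cover:
  assumes "\<not> robust m \<S> {}"
  obtains B where "finite B" "card B \<le> m" "\<And>S. robust m \<S> S \<Longrightarrow> S \<inter> B \<noteq> {}"
proof -
  obtain B where B: "finite B" "card B \<le> m" "\<forall>S\<in>\<S>. S \<inter> B \<noteq> {}"
    using assms unfolding robust_def by auto
  show ?thesis
  proof (rule that[OF B(1,2)])
    show "S \<inter> B \<noteq> {}" if "robust m \<S> S" for S
      using that B unfolding robust_def by (metis Int_commute)
  qed
qed

lemma card_robust_neighbours:
  assumes "\<not> robust m \<S> {v}"
  shows "finite {u. robust m \<S> {v, u}} \<and> card {u. robust m \<S> {v, u}} \<le> m"
proof -
  obtain B where B: "finite B" "card B \<le> m" "v \<notin> B" "\<forall>S\<in>\<S>. S \<inter> B \<noteq> {}"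
    using assms unfolding robust_def by auto
  have "{u. robust m \<S> {v, u}} \<subseteq> B"
  proof
    fix u assume "u \<in> {u. robust m \<S> {v, u}}"
    then have "B \<inter> {v, u} \<noteq> {}" using B unfolding robust_def by auto
    then show "u \<in> B" using B(3) by auto
  qed
  then show ?thesis using B finite_subset card_mono le_trans by metis
qed

section \<open>Exponential moments of permutation sums\<close>

text \<open>The trapezoidal rule overestimates the integral of the convex function \<open>exp\<close> over \<open>[w, u]\<close>.
  This is sharper by a factor \<open>2\<close> than the mean value theorem, and the numerical constants in the theorem rely on it.\<close>

lemma exp_diff_le_mean:
  fixes u w :: real
  shows "(u - w) * (exp u - exp w) \<le> (u - w)\<^sup>2 / 2 * (exp u + exp w)"
proof -
  have key: "exp d - 1 \<le> d / 2 * (exp d + 1)" if "0 \<le> d" for d :: real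
  proof -
    define f where "f d = d / 2 * (exp d + 1) - exp d + 1" for d :: real
    have "f 0 \<le> f d"
    proof (rule DERIV_nonneg_imp_nondecreasing[OF that])
      fix x :: real assume "0 \<le> x" "x \<le> d"
      have "(f has_real_derivative ((exp x + 1) / 2 + x / 2 * exp x - exp x)) (at x)"
        unfolding f_def by (auto intro!: derivative_eq_intros)
      moreover have "0 \<le> (exp x + 1) / 2 + x / 2 * exp x - exp x"
      proof -
        have "1 + - x \<le> exp (- x)" by (rule exp_ge_add_one_self)
        then have "exp x * (1 - x) \<le> exp x * exp (- x)" by (intro mult_left_mono) auto
        then have "exp x * (1 - x) \<le> 1" by (simp flip: exp_add)
        then have "exp x - x * exp x \<le> 1" by (simp add: algebra_simps)
        moreover have eq: "(exp x + 1) / 2 + x / 2 * exp x - exp x = (1 - (exp x - x * exp x)) / 2"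
          by (simp add: field_simps)
        ultimately show ?thesis unfolding eq by simp
      qed
      ultimately show "\<exists>y. (f has_real_derivative y) (at x) \<and> 0 \<le> y" by blast
    qed
    then show ?thesis unfolding f_def by simp
  qed
  have ord: "(u - w) * (exp u - exp w) \<le> (u - w)\<^sup>2 / 2 * (exp u + exp w)" if "w \<le> u" for u w :: real
  proof -
    have "exp w * (exp (u - w) - 1) \<le> exp w * ((u - w) / 2 * (exp (u - w) + 1))"
      using key[of "u - w"] that by (intro mult_left_mono) auto
    then have "exp u - exp w \<le> (u - w) / 2 * (exp u + exp w)"
    proof -
      assume *: "exp w * (exp (u - w) - 1) \<le> exp w * ((u - w) / 2 * (exp (u - w) + 1))"
      have "exp w * exp (u - w) = exp u" by (simp flip: exp_add)
      then have eqs: "exp w * (exp (u - w) - 1) = exp u - exp w"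
        "exp w * ((u - w) / 2 * (exp (u - w) + 1)) = (u - w) / 2 * (exp u + exp w)"
        by (metis mult.right_neutral right_diff_distrib,
            metis (no_types, opaque_lifting) distrib_left mult.left_commute mult.right_neutral)
      show ?thesis using * by (simp only: eqs)
    qed
    then have "(u - w) * (exp u - exp w) \<le> (u - w) * ((u - w) / 2 * (exp u + exp w))"
      using that by (intro mult_left_mono) auto
    then show ?thesis by (simp add: power2_eq_square)
  qed
  show ?thesis
  proof (cases "w \<le> u")
    case False
    have "(u - w) * (exp u - exp w) = (w - u) * (exp w - exp u)" by (simp add: algebra_simps)
    also have "\<dots> \<le> (w - u)\<^sup>2 / 2 * (exp w + exp u)" using False by (intro ord) auto
    finally show ?thesis by (simp add: power2_commute add.commute)
  qed (rule ord)
qed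

text \<open>Let \<open>X(\<pi>) = \<Sum>\<^sub>j a(j, \<pi>(j))\<close> for a uniformly random permutation \<open>\<pi>\<close> of \<open>A\<close>, and let \<open>\<mu>\<close> be its
  mean. Composing \<open>\<pi>\<close> with a random transposition gives an exchangeable pair.\<close>

context
  fixes A :: "'a set" and a :: "'a \<Rightarrow> 'a \<Rightarrow> real"
  assumes finA: "finite A" and neA: "A \<noteq> {}"
begin

definition perm_sum :: "('a \<Rightarrow> 'a) \<Rightarrow> real" where
  "perm_sum \<pi> = (\<Sum>j\<in>A. a j (\<pi> j))"

definition perm_mean :: real where
  "perm_mean = (\<Sum>j\<in>A. \<Sum>v\<in>A. a j v) / card A"

lemma perm_sum_swap:
  assumes "\<pi> permutes A" "i \<in> A" "j \<in> A"
  shows "perm_sum \<pi> - perm_sum (\<pi> \<circ> transpose i j) =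
    a i (\<pi> i) + a j (\<pi> j) - a i (\<pi> j) - a j (\<pi> i)"
proof (cases "i = j")
  case True
  then show ?thesis by simp
next
  case False
  have split: "(\<Sum>l\<in>A. f l) = f i + f j + (\<Sum>l\<in>A - {i, j}. f l)" for f :: "'a \<Rightarrow> real"
  proof -
    have "(\<Sum>l\<in>A. f l) = (\<Sum>l\<in>A - {i, j}. f l) + (\<Sum>l\<in>{i, j}. f l)"
      using assms finA by (intro sum.subset_diff) auto
    then show ?thesis using False by simp
  qed
  have "(\<Sum>l\<in>A - {i, j}. a l ((\<pi> \<circ> transpose i j) l)) = (\<Sum>l\<in>A - {i, j}. a l (\<pi> l))"
    by (intro sum.cong) (auto simp: transpose_def)
  then show ?thesis
    unfolding perm_sum_def split[of "\<lambda>l. a l (\<pi> l)"] split[of "\<lambda>l. a l ((\<pi> \<circ> transpose i j) l)"]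
    by simp
qed

lemma sum_perm_column:
  assumes "\<pi> permutes A"
  shows "(\<Sum>i\<in>A. \<Sum>j\<in>A. a i (\<pi> j)) = card A * perm_mean"
    "(\<Sum>i\<in>A. \<Sum>j\<in>A. a j (\<pi> i)) = card A * perm_mean"
proof -
  have "(\<Sum>j\<in>A. a i (\<pi> j)) = (\<Sum>v\<in>A. a i v)" for i
    using sum.permute[OF assms, of "a i"] by (simp add: o_def)
  then show 1: "(\<Sum>i\<in>A. \<Sum>j\<in>A. a i (\<pi> j)) = card A * perm_mean"
    using finA neA by (simp add: perm_mean_def)
  show "(\<Sum>i\<in>A. \<Sum>j\<in>A. a j (\<pi> i)) = card A * perm_mean"
    by (subst sum.swap) (rule 1)
qed

lemma sum_perm_sum_swap:
  assumes "\<pi> permutes A"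
  shows "(\<Sum>i\<in>A. \<Sum>j\<in>A. perm_sum \<pi> - perm_sum (\<pi> \<circ> transpose i j)) =
    2 * card A * (perm_sum \<pi> - perm_mean)"
proof -
  have "(\<Sum>i\<in>A. \<Sum>j\<in>A. perm_sum \<pi> - perm_sum (\<pi> \<circ> transpose i j)) =
      (\<Sum>i\<in>A. \<Sum>j\<in>A. a i (\<pi> i) + a j (\<pi> j) - a i (\<pi> j) - a j (\<pi> i))"
    by (intro sum.cong refl perm_sum_swap assms)
  also have "\<dots> = 2 * card A * (perm_sum \<pi> - perm_mean)"
    unfolding sum.distrib sum_subtractf sum_perm_column[OF assms]
    by (simp add: perm_sum_def algebra_simps flip: sum_distrib_left sum_distrib_right)
  finally show ?thesis .
qed

lemma sum_perms_swap:
  fixes g :: "('a \<Rightarrow> 'a) \<Rightarrow> ('a \<Rightarrow> 'a) \<Rightarrow> real"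
  assumes "i \<in> A" "j \<in> A"
  shows "(\<Sum>\<pi> | \<pi> permutes A. g \<pi> (\<pi> \<circ> transpose i j)) =
    (\<Sum>\<pi> | \<pi> permutes A. g (\<pi> \<circ> transpose i j) \<pi>)"
proof (rule sum.reindex_bij_witness[where i = "\<lambda>\<pi>. \<pi> \<circ> transpose i j" and j = "\<lambda>\<pi>. \<pi> \<circ> transpose i j"])
  show "\<And>\<pi>. \<pi> \<circ> transpose i j \<circ> transpose i j = \<pi>"
    by (simp add: comp_assoc)
  show "\<And>\<pi>. \<pi> \<in> {\<pi>. \<pi> permutes A} \<Longrightarrow> \<pi> \<circ> transpose i j \<in> {\<pi>. \<pi> permutes A}"
    using assms by (simp add: permutes_compose permutes_swap_id)
qed (use assms in \<open>simp_all add: comp_assoc permutes_compose permutes_swap_id\<close>)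

text \<open>A random transposition changes \<open>X\<close> on average by a multiple of \<open>X - \<mu>\<close> (\<open>sum_perm_sum_swap\<close>); symmetrising
  over the pair expresses the covariance of \<open>X\<close> with \<open>h(X)\<close> through the local differences.\<close>

lemma exchangeable_pair_identity:
  fixes h :: "real \<Rightarrow> real"
  shows "(\<Sum>\<pi> | \<pi> permutes A. (perm_sum \<pi> - perm_mean) * h (perm_sum \<pi>)) =
    (\<Sum>i\<in>A. \<Sum>j\<in>A. \<Sum>\<pi> | \<pi> permutes A. (perm_sum \<pi> - perm_sum (\<pi> \<circ> transpose i j)) *
        (h (perm_sum \<pi>) - h (perm_sum (\<pi> \<circ> transpose i j)))) / (4 * card A)"
proof -
  let ?P = "{\<pi>. \<pi> permutes A}"
  let ?t = "\<lambda>\<pi> i j. \<pi> \<circ> transpose i j"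
  have N: "0 < card A" using finA neA by (simp add: card_gt_0_iff)
  have half: "(\<Sum>\<pi>\<in>?P. (perm_sum \<pi> - perm_sum (?t \<pi> i j)) * (h (perm_sum \<pi>) - h (perm_sum (?t \<pi> i j))))
      = 2 * (\<Sum>\<pi>\<in>?P. (perm_sum \<pi> - perm_sum (?t \<pi> i j)) * h (perm_sum \<pi>))"
    if "i \<in> A" "j \<in> A" for i j
  proof -
    have "(\<Sum>\<pi>\<in>?P. (perm_sum \<pi> - perm_sum (?t \<pi> i j)) * h (perm_sum (?t \<pi> i j))) =
        (\<Sum>\<pi>\<in>?P. (perm_sum (?t \<pi> i j) - perm_sum \<pi>) * h (perm_sum \<pi>))"
      by (rule sum_perms_swap[OF that, of "\<lambda>\<pi> \<sigma>. (perm_sum \<pi> - perm_sum \<sigma>) * h (perm_sum \<sigma>)"])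
    also have "\<dots> = - (\<Sum>\<pi>\<in>?P. (perm_sum \<pi> - perm_sum (?t \<pi> i j)) * h (perm_sum \<pi>))"
      unfolding sum_negf[symmetric] by (intro sum.cong refl) (simp add: algebra_simps)
    finally show ?thesis by (simp add: right_diff_distrib sum_subtractf)
  qed
  have "(\<Sum>i\<in>A. \<Sum>j\<in>A. \<Sum>\<pi>\<in>?P. (perm_sum \<pi> - perm_sum (?t \<pi> i j)) *
        (h (perm_sum \<pi>) - h (perm_sum (?t \<pi> i j)))) =
      (\<Sum>i\<in>A. \<Sum>j\<in>A. 2 * (\<Sum>\<pi>\<in>?P. (perm_sum \<pi> - perm_sum (?t \<pi> i j)) * h (perm_sum \<pi>)))"
    by (intro sum.cong refl half)
  also have "\<dots> = 2 * (\<Sum>i\<in>A. \<Sum>j\<in>A. \<Sum>\<pi>\<in>?P. (perm_sum \<pi> - perm_sum (?t \<pi> i j)) * h (perm_sum \<pi>))"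
    by (simp only: sum_distrib_left)
  also have "(\<Sum>i\<in>A. \<Sum>j\<in>A. \<Sum>\<pi>\<in>?P. (perm_sum \<pi> - perm_sum (?t \<pi> i j)) * h (perm_sum \<pi>)) =
      (\<Sum>\<pi>\<in>?P. \<Sum>i\<in>A. \<Sum>j\<in>A. (perm_sum \<pi> - perm_sum (?t \<pi> i j)) * h (perm_sum \<pi>))"
  proof -
    have "(\<Sum>i\<in>A. \<Sum>j\<in>A. \<Sum>\<pi>\<in>?P. (perm_sum \<pi> - perm_sum (?t \<pi> i j)) * h (perm_sum \<pi>)) =
      (\<Sum>i\<in>A. \<Sum>\<pi>\<in>?P. \<Sum>j\<in>A. (perm_sum \<pi> - perm_sum (?t \<pi> i j)) * h (perm_sum \<pi>))"
      by (intro sum.cong refl sum.swap)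
    also have "\<dots> = (\<Sum>\<pi>\<in>?P. \<Sum>i\<in>A. \<Sum>j\<in>A. (perm_sum \<pi> - perm_sum (?t \<pi> i j)) * h (perm_sum \<pi>))"
      by (rule sum.swap)
    finally show ?thesis .
  qed
  also have "\<dots> = (\<Sum>\<pi>\<in>?P. 2 * card A * (perm_sum \<pi> - perm_mean) * h (perm_sum \<pi>))"
    unfolding sum_distrib_right[symmetric] by (intro sum.cong refl) (simp add: sum_perm_sum_swap)
  also have "\<dots> = 2 * card A * (\<Sum>\<pi>\<in>?P. (perm_sum \<pi> - perm_mean) * h (perm_sum \<pi>))"
    by (simp add: sum_distrib_left mult_ac)
  finally have eq: "(\<Sum>i\<in>A. \<Sum>j\<in>A. \<Sum>\<pi>\<in>?P. (perm_sum \<pi> - perm_sum (?t \<pi> i j)) *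
        (h (perm_sum \<pi>) - h (perm_sum (?t \<pi> i j)))) =
      2 * (2 * card A * (\<Sum>\<pi>\<in>?P. (perm_sum \<pi> - perm_mean) * h (perm_sum \<pi>)))" .
  show ?thesis unfolding eq using N by simp
qed

text \<open>The local variance is controlled by \<open>X\<close> itself: a transposition changes \<open>X\<close> by at most \<open>2\<close> and by at most the
  sum of the four entries involved, so the square of the change is at most twice this sum.\<close>

lemma sum_sq_perm_sum_swap:
  assumes \<pi>: "\<pi> permutes A" and a01: "\<And>i v. i \<in> A \<Longrightarrow> v \<in> A \<Longrightarrow> 0 \<le> a i v \<and> a i v \<le> 1"
  shows "(\<Sum>i\<in>A. \<Sum>j\<in>A. (perm_sum \<pi> - perm_sum (\<pi> \<circ> transpose i j))\<^sup>2) \<le>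
    4 * card A * (perm_sum \<pi> + perm_mean)"
proof -
  have "(\<Sum>i\<in>A. \<Sum>j\<in>A. (perm_sum \<pi> - perm_sum (\<pi> \<circ> transpose i j))\<^sup>2) \<le>
      (\<Sum>i\<in>A. \<Sum>j\<in>A. 2 * (a i (\<pi> i) + a j (\<pi> j) + a i (\<pi> j) + a j (\<pi> i)))"
  proof (intro sum_mono)
    fix i j assume ij: "i \<in> A" "j \<in> A"
    have p: "\<pi> i \<in> A" "\<pi> j \<in> A" using ij permutes_in_image[OF \<pi>] by auto
    define b c d e where "b = a i (\<pi> i)" and "c = a j (\<pi> j)" and "d = a i (\<pi> j)" and "e = a j (\<pi> i)"
    have b: "0 \<le> b" "b \<le> 1" "0 \<le> c" "c \<le> 1" "0 \<le> d" "d \<le> 1" "0 \<le> e" "e \<le> 1"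
      using a01 ij p unfolding b_def c_def d_def e_def by auto
    have "\<bar>b + c - d - e\<bar> * \<bar>b + c - d - e\<bar> \<le> 2 * (b + c + d + e)"
      using b by (intro mult_mono) auto
    then have "(b + c - d - e)\<^sup>2 \<le> 2 * (b + c + d + e)" by (simp add: power2_eq_square)
    then show "(perm_sum \<pi> - perm_sum (\<pi> \<circ> transpose i j))\<^sup>2 \<le>
        2 * (a i (\<pi> i) + a j (\<pi> j) + a i (\<pi> j) + a j (\<pi> i))"
      unfolding perm_sum_swap[OF \<pi> ij] b_def c_def d_def e_def .
  qed
  also have "\<dots> = 4 * card A * (perm_sum \<pi> + perm_mean)"
    unfolding sum_distrib_left[symmetric] sum.distrib sum_perm_column[OF \<pi>]
    by (simp add: perm_sum_def algebra_simps flip: sum_distrib_left sum_distrib_right)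
  finally show ?thesis .
qed

text \<open>The exchangeable pair turns the bound on the local variance into a differential inequality for the
  moment generating function \<open>M\<close>, namely \<open>M' \<le> \<tau> (\<sigma> M' + 2 \<mu> M)\<close>. For \<open>\<tau> \<le> 1/2\<close> it gives
  \<open>M' \<le> 4 \<mu> \<tau> M\<close>, which integrates to the claim. Both tails are needed, hence the sign \<open>\<sigma>\<close>.\<close>

lemma perm_sum_mgf:
  assumes a01: "\<And>i v. i \<in> A \<Longrightarrow> v \<in> A \<Longrightarrow> 0 \<le> a i v \<and> a i v \<le> 1"
    and \<sigma>: "\<sigma> \<in> {1, -1}" and \<tau>: "0 \<le> \<tau>" "\<tau> \<le> 1/2"
  shows "(\<Sum>\<pi> | \<pi> permutes A. exp (\<sigma> * \<tau> * (perm_sum \<pi> - perm_mean))) \<le>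
    card {\<pi>. \<pi> permutes A} * exp (2 * perm_mean * \<tau>\<^sup>2)"
proof -
  let ?P = "{\<pi>. \<pi> permutes A}"
  let ?t = "\<lambda>\<pi> i j. \<pi> \<circ> transpose i j"
  have N: "0 < card A" using finA neA by (simp add: card_gt_0_iff)
  have mean0: "0 \<le> perm_mean" unfolding perm_mean_def using a01 by (auto intro!: divide_nonneg_nonneg sum_nonneg)
  have \<sigma>1: "\<bar>\<sigma>\<bar> = 1" "\<sigma> * \<sigma> = 1" using \<sigma> by auto
  define E where "E \<tau> x = exp (\<sigma> * \<tau> * (x - perm_mean))" for \<tau> x
  define M where "M \<tau> = (\<Sum>\<pi>\<in>?P. E \<tau> (perm_sum \<pi>))" for \<tau>
  define M' where "M' \<tau> = (\<Sum>\<pi>\<in>?P. (perm_sum \<pi> - perm_mean) * (\<sigma> * E \<tau> (perm_sum \<pi>)))" for \<tau>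
  have E0: "0 \<le> E \<tau> x" for \<tau> x by (simp add: E_def)
  have M0: "0 \<le> M \<tau>" for \<tau> unfolding M_def by (intro sum_nonneg E0)
  have deriv: "(M has_real_derivative M' \<tau>) (at \<tau>)" for \<tau>
    unfolding M_def M'_def E_def by (auto intro!: derivative_eq_intros sum.cong)
  have bound: "M' \<tau> \<le> 4 * perm_mean * \<tau> * M \<tau>" if \<tau>: "0 \<le> \<tau>" "\<tau> \<le> 1/2" for \<tau>
  proof -
    have pt: "(x - y) * (\<sigma> * E \<tau> x - \<sigma> * E \<tau> y) \<le> \<tau> / 2 * ((x - y)\<^sup>2 * E \<tau> x + (x - y)\<^sup>2 * E \<tau> y)" for x y
    proof (cases "\<tau> = 0")
      case True
      then show ?thesis by (simp add: E_def)
    next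
      case False
      then have \<tau>p: "0 < \<tau>" using \<tau> by simp
      define u w where "u = \<sigma> * \<tau> * (x - perm_mean)" and "w = \<sigma> * \<tau> * (y - perm_mean)"
      have d: "u - w = \<tau> * (\<sigma> * (x - y))" unfolding u_def w_def by (simp add: algebra_simps)
      have eu: "E \<tau> x = exp u" "E \<tau> y = exp w" by (simp_all add: E_def u_def w_def)
      have "\<tau> * ((x - y) * (\<sigma> * E \<tau> x - \<sigma> * E \<tau> y)) = (u - w) * (exp u - exp w)"
        unfolding d eu by (simp add: algebra_simps)
      also have "\<dots> \<le> (u - w)\<^sup>2 / 2 * (exp u + exp w)" by (rule exp_diff_le_mean)
      also have "(u - w)\<^sup>2 = \<tau>\<^sup>2 * (\<sigma> * \<sigma>) * (x - y)\<^sup>2" unfolding d by (simp add: power2_eq_square)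
      also have "\<tau>\<^sup>2 * (\<sigma> * \<sigma>) * (x - y)\<^sup>2 / 2 * (exp u + exp w) =
          \<tau> * (\<tau> / 2 * ((x - y)\<^sup>2 * E \<tau> x + (x - y)\<^sup>2 * E \<tau> y))"
        unfolding \<sigma>1 eu by (simp add: distrib_left power2_eq_square)
      finally show ?thesis by (simp only: mult_le_cancel_left_pos[OF \<tau>p])
    qed
    have dbl: "\<tau> / 2 * (z + z) = \<tau> * z" for z by simp
    have "M' \<tau> = (\<Sum>i\<in>A. \<Sum>j\<in>A. \<Sum>\<pi>\<in>?P. (perm_sum \<pi> - perm_sum (?t \<pi> i j)) *
        (\<sigma> * E \<tau> (perm_sum \<pi>) - \<sigma> * E \<tau> (perm_sum (?t \<pi> i j)))) / (4 * card A)"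
      unfolding M'_def by (rule exchangeable_pair_identity)
    also have "\<dots> \<le> (\<Sum>i\<in>A. \<Sum>j\<in>A. \<tau> * (\<Sum>\<pi>\<in>?P.
        (perm_sum \<pi> - perm_sum (?t \<pi> i j))\<^sup>2 * E \<tau> (perm_sum \<pi>))) / (4 * card A)"
    proof (intro divide_right_mono sum_mono)
      fix i j assume ij: "i \<in> A" "j \<in> A"
      have "(\<Sum>\<pi>\<in>?P. (perm_sum \<pi> - perm_sum (?t \<pi> i j)) *
        (\<sigma> * E \<tau> (perm_sum \<pi>) - \<sigma> * E \<tau> (perm_sum (?t \<pi> i j)))) \<le>
        (\<Sum>\<pi>\<in>?P. \<tau> / 2 * ((perm_sum \<pi> - perm_sum (?t \<pi> i j))\<^sup>2 * E \<tau> (perm_sum \<pi>) +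
          (perm_sum \<pi> - perm_sum (?t \<pi> i j))\<^sup>2 * E \<tau> (perm_sum (?t \<pi> i j))))"
        by (intro sum_mono pt)
      also have "\<dots> = \<tau> / 2 * ((\<Sum>\<pi>\<in>?P. (perm_sum \<pi> - perm_sum (?t \<pi> i j))\<^sup>2 * E \<tau> (perm_sum \<pi>)) +
          (\<Sum>\<pi>\<in>?P. (perm_sum \<pi> - perm_sum (?t \<pi> i j))\<^sup>2 * E \<tau> (perm_sum (?t \<pi> i j))))"
        by (simp only: sum_distrib_left[symmetric] sum.distrib)
      also have "(\<Sum>\<pi>\<in>?P. (perm_sum \<pi> - perm_sum (?t \<pi> i j))\<^sup>2 * E \<tau> (perm_sum (?t \<pi> i j))) =
          (\<Sum>\<pi>\<in>?P. (perm_sum \<pi> - perm_sum (?t \<pi> i j))\<^sup>2 * E \<tau> (perm_sum \<pi>))"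
        by (subst sum_perms_swap[OF ij, of "\<lambda>\<pi> \<sigma>. (perm_sum \<pi> - perm_sum \<sigma>)\<^sup>2 * E \<tau> (perm_sum \<sigma>)"])
          (simp add: power2_commute)
      finally show "(\<Sum>\<pi>\<in>?P. (perm_sum \<pi> - perm_sum (?t \<pi> i j)) *
        (\<sigma> * E \<tau> (perm_sum \<pi>) - \<sigma> * E \<tau> (perm_sum (?t \<pi> i j)))) \<le>
        \<tau> * (\<Sum>\<pi>\<in>?P. (perm_sum \<pi> - perm_sum (?t \<pi> i j))\<^sup>2 * E \<tau> (perm_sum \<pi>))" by (simp only: dbl)
    qed simp
    also have "(\<Sum>i\<in>A. \<Sum>j\<in>A. \<tau> * (\<Sum>\<pi>\<in>?P.
        (perm_sum \<pi> - perm_sum (?t \<pi> i j))\<^sup>2 * E \<tau> (perm_sum \<pi>))) =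
        \<tau> * (\<Sum>\<pi>\<in>?P. (\<Sum>i\<in>A. \<Sum>j\<in>A. (perm_sum \<pi> - perm_sum (?t \<pi> i j))\<^sup>2) * E \<tau> (perm_sum \<pi>))"
    proof -
      have "(\<Sum>i\<in>A. \<Sum>j\<in>A. \<Sum>\<pi>\<in>?P. (perm_sum \<pi> - perm_sum (?t \<pi> i j))\<^sup>2 * E \<tau> (perm_sum \<pi>)) =
        (\<Sum>i\<in>A. \<Sum>\<pi>\<in>?P. \<Sum>j\<in>A. (perm_sum \<pi> - perm_sum (?t \<pi> i j))\<^sup>2 * E \<tau> (perm_sum \<pi>))"
        by (intro sum.cong refl sum.swap)
      also have "\<dots> = (\<Sum>\<pi>\<in>?P. \<Sum>i\<in>A. \<Sum>j\<in>A. (perm_sum \<pi> - perm_sum (?t \<pi> i j))\<^sup>2 * E \<tau> (perm_sum \<pi>))"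
        by (rule sum.swap)
      finally show ?thesis by (simp only: sum_distrib_left[symmetric] sum_distrib_right)
    qed
    also have "\<tau> * (\<Sum>\<pi>\<in>?P. (\<Sum>i\<in>A. \<Sum>j\<in>A. (perm_sum \<pi> - perm_sum (?t \<pi> i j))\<^sup>2) * E \<tau> (perm_sum \<pi>)) / (4 * card A)
        \<le> \<tau> * (\<Sum>\<pi>\<in>?P. (4 * card A * (perm_sum \<pi> + perm_mean)) * E \<tau> (perm_sum \<pi>)) / (4 * card A)"
      using \<tau> a01 E0
      by (intro divide_right_mono mult_left_mono sum_mono mult_right_mono sum_sq_perm_sum_swap) auto
    also have "\<dots> = \<tau> * (\<Sum>\<pi>\<in>?P. (perm_sum \<pi> + perm_mean) * E \<tau> (perm_sum \<pi>))"
      using N by (simp add: mult.assoc flip: sum_distrib_left)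
    also have "(\<Sum>\<pi>\<in>?P. (perm_sum \<pi> + perm_mean) * E \<tau> (perm_sum \<pi>)) = \<sigma> * M' \<tau> + 2 * perm_mean * M \<tau>"
    proof -
      have "(x + perm_mean) * e = \<sigma> * ((x - perm_mean) * (\<sigma> * e)) + 2 * perm_mean * e" for x e :: real
      proof -
        have "\<sigma> * ((x - perm_mean) * (\<sigma> * e)) = (\<sigma> * \<sigma>) * ((x - perm_mean) * e)" by (simp add: mult_ac)
        then show ?thesis unfolding \<sigma>1 by (simp add: algebra_simps)
      qed
      then show ?thesis
        unfolding M'_def M_def sum_distrib_left sum.distrib[symmetric] by (intro sum.cong refl)
    qed
    finally have *: "M' \<tau> \<le> \<tau> * (\<sigma> * M' \<tau> + 2 * perm_mean * M \<tau>)" .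
    have rhs0: "0 \<le> 4 * perm_mean * \<tau> * M \<tau>" using mean0 \<tau> M0 by simp
    show ?thesis
    proof (cases "0 \<le> M' \<tau>")
      case True
      have "\<tau> * (\<sigma> * M' \<tau>) \<le> 1/2 * M' \<tau>"
      proof -
        have "\<tau> * \<sigma> \<le> 1/2" using \<tau> \<sigma> by auto
        then show ?thesis using True mult_right_mono[of "\<tau> * \<sigma>" "1/2" "M' \<tau>"] by (simp add: mult.assoc)
      qed
      then show ?thesis using * by (simp add: algebra_simps)
    qed (use rhs0 in linarith)
  qed
  define g where "g \<tau> = M \<tau> * exp (- (2 * perm_mean * \<tau>\<^sup>2))" for \<tau>
  have "g \<tau> \<le> g 0"
  proof (rule DERIV_nonpos_imp_nonincreasing[OF \<tau>(1)])
    fix x assume x: "0 \<le> x" "x \<le> \<tau>"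
    have "(g has_real_derivative (M' x - 4 * perm_mean * x * M x) * exp (- (2 * perm_mean * x\<^sup>2))) (at x)"
      unfolding g_def
      by (auto intro!: derivative_eq_intros deriv simp: algebra_simps)
    moreover have "(M' x - 4 * perm_mean * x * M x) * exp (- (2 * perm_mean * x\<^sup>2)) \<le> 0"
      using bound[of x] x \<tau> by (simp add: mult_le_0_iff)
    ultimately show "\<exists>y. (g has_real_derivative y) (at x) \<and> y \<le> 0" by blast
  qed
  also have "g 0 = card ?P" by (simp add: g_def M_def E_def)
  finally show ?thesis unfolding g_def M_def E_def
    by (simp add: exp_minus field_simps)
qed

end

text \<open>Parts of the matrix that depend only on the row or only on the column contribute a constant to the permutation sum. So only the
  remaining entries matter, and the positive and the negative ones among
  them are separated by the inequality between the arithmetic and the geometric mean.\<close>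

lemma perm_sum_lower_mgf:
  fixes a :: "'a \<Rightarrow> 'a \<Rightarrow> real"
  assumes A: "finite A" "A \<noteq> {}"
    and dec: "\<And>j v. j \<in> A \<Longrightarrow> v \<in> A \<Longrightarrow> a j v = r j + w v + p j v - q j v"
    and p: "\<And>j v. j \<in> A \<Longrightarrow> v \<in> A \<Longrightarrow> 0 \<le> p j v \<and> p j v \<le> 1"
    and q: "\<And>j v. j \<in> A \<Longrightarrow> v \<in> A \<Longrightarrow> 0 \<le> q j v \<and> q j v \<le> 1"
    and \<theta>: "0 \<le> \<theta>" "\<theta> \<le> 1/4"
  shows "(\<Sum>\<pi> | \<pi> permutes A. exp (- \<theta> * (perm_sum A a \<pi> - perm_mean A a)))
    \<le> card {\<pi>. \<pi> permutes A} * exp (4 * \<theta>\<^sup>2 * (perm_mean A p + perm_mean A q))"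
proof -
  let ?P = "{\<pi>. \<pi> permutes A}"
  have N: "0 < card A" using A by (simp add: card_gt_0_iff)
  have split: "perm_sum A a \<pi> - perm_mean A a =
      (perm_sum A p \<pi> - perm_mean A p) - (perm_sum A q \<pi> - perm_mean A q)" if "\<pi> \<in> ?P" for \<pi>
  proof -
    have \<pi>: "\<pi> permutes A" using that by simp
    have "perm_sum A a \<pi> = (\<Sum>j\<in>A. r j + w (\<pi> j) + p j (\<pi> j) - q j (\<pi> j))"
      unfolding perm_sum_def[OF A] using permutes_in_image[OF \<pi>] by (intro sum.cong refl dec) auto
    also have "\<dots> = (\<Sum>j\<in>A. r j) + (\<Sum>j\<in>A. w j) + perm_sum A p \<pi> - perm_sum A q \<pi>"
      using sum.permute[OF \<pi>, of w] by (simp add: sum.distrib sum_subtractf perm_sum_def[OF A] o_def)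
    finally have 1: "perm_sum A a \<pi> = (\<Sum>j\<in>A. r j) + (\<Sum>j\<in>A. w j) + perm_sum A p \<pi> - perm_sum A q \<pi>" .
    have "(\<Sum>j\<in>A. \<Sum>v\<in>A. a j v) = (\<Sum>j\<in>A. \<Sum>v\<in>A. r j + w v + p j v - q j v)"
      by (intro sum.cong refl dec)
    also have "\<dots> = card A * (\<Sum>j\<in>A. r j) + card A * (\<Sum>j\<in>A. w j) + (\<Sum>j\<in>A. \<Sum>v\<in>A. p j v) - (\<Sum>j\<in>A. \<Sum>v\<in>A. q j v)"
      by (simp add: sum.distrib sum_subtractf sum_distrib_left)
    finally have 2: "perm_mean A a = (\<Sum>j\<in>A. r j) + (\<Sum>j\<in>A. w j) + perm_mean A p - perm_mean A q"
      using N by (simp add: perm_mean_def[OF A] add_divide_distrib diff_divide_distrib)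
    show ?thesis unfolding 1 2 by simp
  qed
  let ?B = "4 * \<theta>\<^sup>2 * (perm_mean A p + perm_mean A q)"
  let ?p = "\<lambda>\<pi>. exp (-1 * (2 * \<theta>) * (perm_sum A p \<pi> - perm_mean A p))"
  let ?q = "\<lambda>\<pi>. exp (1 * (2 * \<theta>) * (perm_sum A q \<pi> - perm_mean A q))"
  have amgm: "exp (x + y) \<le> (exp (2 * x) + exp (2 * y)) / 2" for x y :: real
    using sum_squares_bound[of "exp x" "exp y"] by (simp add: exp_add exp_double power2_eq_square)
  have pt: "exp (- \<theta> * (perm_sum A a \<pi> - perm_mean A a)) * exp (- ?B) \<le>
     (?p \<pi> * exp (- (8 * \<theta>\<^sup>2 * perm_mean A p)) + ?q \<pi> * exp (- (8 * \<theta>\<^sup>2 * perm_mean A q))) / 2"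
    if "\<pi> \<in> ?P" for \<pi>
  proof -
    have "exp (- \<theta> * (perm_sum A a \<pi> - perm_mean A a)) * exp (- ?B) =
      exp ((- \<theta> * (perm_sum A p \<pi> - perm_mean A p) - 4 * \<theta>\<^sup>2 * perm_mean A p) +
           (\<theta> * (perm_sum A q \<pi> - perm_mean A q) - 4 * \<theta>\<^sup>2 * perm_mean A q))"
      unfolding split[OF that] exp_add[symmetric] by (rule arg_cong[where f = exp]) (simp add: algebra_simps)
    also have "\<dots> \<le> (exp (2 * (- \<theta> * (perm_sum A p \<pi> - perm_mean A p) - 4 * \<theta>\<^sup>2 * perm_mean A p)) +
           exp (2 * (\<theta> * (perm_sum A q \<pi> - perm_mean A q) - 4 * \<theta>\<^sup>2 * perm_mean A q))) / 2"
      by (rule amgm)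
    also have "\<dots> = (?p \<pi> * exp (- (8 * \<theta>\<^sup>2 * perm_mean A p)) + ?q \<pi> * exp (- (8 * \<theta>\<^sup>2 * perm_mean A q))) / 2"
      unfolding exp_add[symmetric] by (simp add: algebra_simps)
    finally show ?thesis .
  qed
  have mp: "(\<Sum>\<pi>\<in>?P. ?p \<pi>) * exp (- (8 * \<theta>\<^sup>2 * perm_mean A p)) \<le> card ?P"
    using perm_sum_mgf[OF A, of p "-1" "2 * \<theta>"] p \<theta> by (simp add: exp_minus field_simps power2_eq_square)
  have mq: "(\<Sum>\<pi>\<in>?P. ?q \<pi>) * exp (- (8 * \<theta>\<^sup>2 * perm_mean A q)) \<le> card ?P"
    using perm_sum_mgf[OF A, of q "1" "2 * \<theta>"] q \<theta> by (simp add: exp_minus field_simps power2_eq_square)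
  have "(\<Sum>\<pi>\<in>?P. exp (- \<theta> * (perm_sum A a \<pi> - perm_mean A a))) * exp (- ?B) \<le>
      (\<Sum>\<pi>\<in>?P. (?p \<pi> * exp (- (8 * \<theta>\<^sup>2 * perm_mean A p)) + ?q \<pi> * exp (- (8 * \<theta>\<^sup>2 * perm_mean A q))) / 2)"
    unfolding sum_distrib_right by (intro sum_mono pt)
  also have "\<dots> = ((\<Sum>\<pi>\<in>?P. ?p \<pi>) * exp (- (8 * \<theta>\<^sup>2 * perm_mean A p)) +
      (\<Sum>\<pi>\<in>?P. ?q \<pi>) * exp (- (8 * \<theta>\<^sup>2 * perm_mean A q))) / 2"
    by (simp only: sum_divide_distrib[symmetric] sum.distrib sum_distrib_right)
  also have "\<dots> \<le> card ?P" using mp mq by simp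
  finally show ?thesis by (simp only: exp_minus) (simp add: field_simps)
qed

section \<open>Conditional hitting probabilities\<close>

definition avg_coord :: "nat \<Rightarrow> nat \<Rightarrow> ((nat \<Rightarrow> nat) \<Rightarrow> real) \<Rightarrow> (nat \<Rightarrow> nat) \<Rightarrow> real" where
  "avg_coord n i \<phi> x = (\<Sum>v\<in>{1..n}. \<phi> (x(i := v))) / real n"

text \<open>The conditional expectation of \<open>\<phi>\<close>, given the first \<open>c\<close> coordinates of a uniformly random tuple, is
  obtained by averaging over the coordinates \<open>c + 1, \<dots>, k\<close>. It is a function on all tuples that
  ignores the current values of these coordinates.\<close>

definition tail_avg :: "nat \<Rightarrow> nat \<Rightarrow> nat \<Rightarrow> ((nat \<Rightarrow> nat) \<Rightarrow> real) \<Rightarrow> (nat \<Rightarrow> nat) \<Rightarrow> real" where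
  "tail_avg n k c \<phi> = foldr (avg_coord n) [Suc c..<Suc k] \<phi>"

lemma tail_avg_top [simp]: "tail_avg n k k \<phi> = \<phi>"
  by (simp add: tail_avg_def)

lemma tail_avg_step: "c < k \<Longrightarrow> tail_avg n k c \<phi> = avg_coord n (Suc c) (tail_avg n k (Suc c) \<phi>)"
  by (simp add: tail_avg_def upt_conv_Cons del: upt_Suc)

lemma tail_avg_mono:
  assumes "c \<le> k" "\<And>x. \<phi> x \<le> \<psi> x"
  shows "tail_avg n k c \<phi> x \<le> tail_avg n k c \<psi> x"
  using assms(1)
proof (induction arbitrary: x rule: inc_induct)
  case base
  then show ?case using assms(2) by simp
next
  case (step c)
  then show ?case
    by (auto simp: tail_avg_step avg_coord_def intro!: divide_right_mono sum_mono)
qed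

lemma tail_avg_add:
  assumes "c \<le> k"
  shows "tail_avg n k c (\<lambda>x. \<phi> x + \<psi> x) x = tail_avg n k c \<phi> x + tail_avg n k c \<psi> x"
  using assms
proof (induction arbitrary: x rule: inc_induct)
  case (step c)
  then show ?case
    by (simp add: tail_avg_step avg_coord_def sum.distrib add_divide_distrib del: fun_upd_apply)
qed simp

lemma tail_avg_const:
  assumes "c \<le> k" "0 < n"
  shows "tail_avg n k c (\<lambda>x. a) x = a"
  using assms(1)
proof (induction arbitrary: x rule: inc_induct)
  case (step c)
  then show ?case using assms(2) by (simp add: tail_avg_step avg_coord_def)
qed simp

lemma tail_avg_uminus:
  assumes "c \<le> k"
  shows "tail_avg n k c (\<lambda>x. - \<phi> x) x = - tail_avg n k c \<phi> x"
  using assms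
proof (induction arbitrary: x rule: inc_induct)
  case (step c)
  then show ?case
    by (simp add: tail_avg_step avg_coord_def sum_negf del: fun_upd_apply)
qed simp

lemma tail_avg_sum:
  assumes "c \<le> k" "0 < n"
  shows "tail_avg n k c (\<lambda>x. \<Sum>u\<in>U. \<phi> u x) x = (\<Sum>u\<in>U. tail_avg n k c (\<phi> u) x)"
proof (induction U rule: infinite_finite_induct)
  case (insert u U)
  then show ?case using tail_avg_add[OF assms(1)] by simp
qed (simp_all add: tail_avg_const[OF assms])

lemma tail_avg_indep:
  assumes "c \<le> k" "\<And>x v. \<phi> (x(i := v)) = \<phi> x"
  shows "tail_avg n k c \<phi> (x(i := v)) = tail_avg n k c \<phi> x"
  using assms(1)
proof (induction arbitrary: x rule: inc_induct)
  case base
  then show ?case using assms(2) by (simp del: fun_upd_apply)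
next
  case (step c)
  have "tail_avg n k (Suc c) \<phi> (x(i := v, Suc c := w)) = tail_avg n k (Suc c) \<phi> (x(Suc c := w))" for w
  proof (cases "i = Suc c")
    case False
    then have "x(i := v, Suc c := w) = x(Suc c := w, i := v)" by (rule fun_upd_twist)
    then show ?thesis using step.IH by (simp del: fun_upd_apply)
  qed simp
  then show ?case using step.hyps by (simp add: tail_avg_step avg_coord_def del: fun_upd_apply)
qed

lemma tail_avg_0:
  assumes "0 < n"
  shows "tail_avg n k 0 \<phi> (\<lambda>_. undefined) = (\<Sum>x\<in>tuples n k. \<phi> x) / real n ^ k"
proof -
  have "(\<Sum>x\<in>{1..c} \<rightarrow>\<^sub>E {1..n}. tail_avg n k c \<phi> x) / real n ^ c =
      tail_avg n k 0 \<phi> (\<lambda>_. undefined)" if "c \<le> k" for c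
    using that
  proof (induction c)
    case 0
    then show ?case by simp
  next
    case (Suc c)
    have ins: "{1..Suc c} = insert (Suc c) {1..c}" by auto
    have "(\<Sum>x\<in>{1..Suc c} \<rightarrow>\<^sub>E {1..n}. tail_avg n k (Suc c) \<phi> x) =
        (\<Sum>x\<in>{1..c} \<rightarrow>\<^sub>E {1..n}. \<Sum>v\<in>{1..n}. tail_avg n k (Suc c) \<phi> (x(Suc c := v)))"
      unfolding ins by (subst sum_PiE_insert, simp) (rule sum.swap)
    also have "\<dots> = (\<Sum>x\<in>{1..c} \<rightarrow>\<^sub>E {1..n}. real n * tail_avg n k c \<phi> x)"
      using Suc.prems assms by (intro sum.cong refl) (simp add: tail_avg_step avg_coord_def)
    also have "\<dots> = real n * (\<Sum>x\<in>{1..c} \<rightarrow>\<^sub>E {1..n}. tail_avg n k c \<phi> x)"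
      by (rule sum_distrib_left[symmetric])
    finally show ?case using Suc assms by simp
  qed
  from this[of k] show ?thesis by (simp add: tuples_def)
qed

definition has_vertex :: "nat \<Rightarrow> nat \<times> nat \<Rightarrow> (nat \<Rightarrow> nat) \<Rightarrow> real" where
  "has_vertex k e x = of_bool (e \<in> gr k x)"

lemma has_vertex_nonneg [simp]: "0 \<le> has_vertex k e x"
  by (simp add: has_vertex_def)

lemma has_vertex_upd: "fst e \<noteq> i \<Longrightarrow> has_vertex k e (x(i := v)) = has_vertex k e x"
  by (cases e) (simp add: has_vertex_def mem_gr)

lemma tail_avg_has_vertex_past:
  assumes "c \<le> k" "0 < n" "fst e \<le> c"
  shows "tail_avg n k c (has_vertex k e) x = has_vertex k e x"
  using assms(1,3)
proof (induction arbitrary: x rule: inc_induct)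
  case (step c)
  then show ?case
    using assms(2) by (simp add: tail_avg_step avg_coord_def has_vertex_upd)
qed simp

lemma tail_avg_has_vertex_future:
  assumes "c \<le> k" "0 < n" "c < fst e"
  shows "tail_avg n k c (has_vertex k e) x \<le> 1 / real n"
  using assms(1,3)
proof (induction arbitrary: x rule: inc_induct)
  case base
  then have "e \<notin> gr k x" by (cases e) (simp add: mem_gr)
  then show ?case by (simp add: has_vertex_def)
next
  case (step c)
  show ?case
  proof (cases "Suc c < fst e")
    case True
    have "(\<Sum>v\<in>{1..n}. tail_avg n k (Suc c) (has_vertex k e) (x(Suc c := v))) \<le> (\<Sum>v\<in>{1..n}. 1 / real n)"
      using step.IH[OF True] by (intro sum_mono)
    then show ?thesis using step.hyps assms(2)
      by (simp add: tail_avg_step avg_coord_def divide_right_mono)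
  next
    case False
    then have e: "fst e = Suc c" using step.prems by simp
    have "(\<Sum>v\<in>{1..n}. tail_avg n k (Suc c) (has_vertex k e) (x(Suc c := v))) =
        (\<Sum>v\<in>{1..n}. if v = snd e then 1 else 0)"
      using step.hyps assms(2) e
      by (intro sum.cong refl, subst tail_avg_has_vertex_past)
        (cases e; auto simp: has_vertex_def mem_gr)+
    also have "\<dots> \<le> (1::real)" by (simp add: sum.delta)
    finally show ?thesis using step.hyps assms(2)
      by (simp add: tail_avg_step avg_coord_def divide_right_mono)
  qed
qed

text \<open>Among \<open>n\<close> tuples with distinct entries in each revealed coordinate, at most one contains a given vertex, if
  its coordinate has been revealed; otherwise each of them contains it with probability at most \<open>1/n\<close>.\<close>

lemma sum_tail_avg_has_vertex:
  assumes "c \<le> k" "0 < n" "fst e \<le> c \<Longrightarrow> fst e \<in> {1..k} \<Longrightarrow> inj_on (\<lambda>j. y j (fst e)) {1..n}"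
  shows "(\<Sum>j\<in>{1..n}. tail_avg n k c (has_vertex k e) (y j)) \<le> 1"
proof (cases "fst e \<le> c")
  case False
  then have "(\<Sum>j\<in>{1..n}. tail_avg n k c (has_vertex k e) (y j)) \<le> (\<Sum>j\<in>{1..n}. 1 / real n)"
    using assms by (intro sum_mono tail_avg_has_vertex_future) auto
  then show ?thesis using assms(2) by simp
next
  case True
  have "(\<Sum>j\<in>{1..n}. tail_avg n k c (has_vertex k e) (y j)) = (\<Sum>j\<in>{1..n}. has_vertex k e (y j))"
    using assms True by (intro sum.cong refl tail_avg_has_vertex_past)
  also have "\<dots> = real (card {j\<in>{1..n}. e \<in> gr k (y j)})"
    by (simp add: has_vertex_def sum.If_cases of_bool_def Int_def)
  also have "\<dots> \<le> 1"
  proof -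
    have "card {j\<in>{1..n}. e \<in> gr k (y j)} \<le> Suc 0"
    proof (subst card_le_Suc0_iff_eq)
      show "\<forall>a\<in>{j\<in>{1..n}. e \<in> gr k (y j)}. \<forall>b\<in>{j\<in>{1..n}. e \<in> gr k (y j)}. a = b"
      proof (intro ballI)
        fix a b assume a: "a \<in> {j\<in>{1..n}. e \<in> gr k (y j)}" and b: "b \<in> {j\<in>{1..n}. e \<in> gr k (y j)}"
        have "fst e \<in> {1..k}" "y a (fst e) = y b (fst e)"
          using a b by (cases e; auto simp: mem_gr)+
        then show "a = b" using assms(3)[OF True] a b by (auto dest: inj_onD)
      qed
    qed simp
    then show ?thesis by simp
  qed
  finally show ?thesis .
qed

definition hits :: "nat \<Rightarrow> (nat \<times> nat) set set \<Rightarrow> (nat \<Rightarrow> nat) \<Rightarrow> real" where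
  "hits k K x = of_bool (\<exists>S\<in>K. S \<subseteq> gr k x)"

lemma hits_bounds: "0 \<le> hits k K x" "hits k K x \<le> 1"
  by (simp_all add: hits_def)

lemma hits_mono: "K \<subseteq> L \<Longrightarrow> hits k K x \<le> hits k L x"
  by (auto simp: hits_def)

lemma tail_avg_hits_bounds:
  assumes "c \<le> k" "0 < n"
  shows "0 \<le> tail_avg n k c (hits k K) x" "tail_avg n k c (hits k K) x \<le> 1"
  using tail_avg_mono[OF assms(1), of "\<lambda>_. 0" "hits k K"] tail_avg_mono[OF assms(1), of "hits k K" "\<lambda>_. 1"]
    tail_avg_const[OF assms] hits_bounds by metis+

lemma sum_tail_avg_cover:
  assumes c: "c \<le> k" "0 < n" and y: "\<And>i. i \<in> {1..c} \<Longrightarrow> inj_on (\<lambda>j. y j i) {1..n}"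
    and B: "finite B" "\<And>S. S \<in> K \<Longrightarrow> S \<inter> B \<noteq> {}"
  shows "(\<Sum>j\<in>{1..n}. tail_avg n k c (hits k K) (y j)) \<le> real (card B)"
proof -
  have "hits k K x \<le> (\<Sum>b\<in>B. has_vertex k b x)" for x
  proof (cases "\<exists>S\<in>K. S \<subseteq> gr k x")
    case True
    then obtain S b where "S \<in> K" "S \<subseteq> gr k x" "b \<in> S" "b \<in> B" using B(2) by blast
    then have "1 \<le> has_vertex k b x" by (auto simp: has_vertex_def)
    also have "\<dots> \<le> (\<Sum>b\<in>B. has_vertex k b x)"
      using B(1) \<open>b \<in> B\<close> by (intro member_le_sum) auto
    finally show ?thesis using hits_bounds(2)[of k K x] by linarith
  qed (simp add: hits_def sum_nonneg)
  then have "(\<Sum>j\<in>{1..n}. tail_avg n k c (hits k K) (y j)) \<le>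
      (\<Sum>j\<in>{1..n}. tail_avg n k c (\<lambda>x. \<Sum>b\<in>B. has_vertex k b x) (y j))"
    by (intro sum_mono tail_avg_mono c)
  also have "\<dots> = (\<Sum>b\<in>B. \<Sum>j\<in>{1..n}. tail_avg n k c (has_vertex k b) (y j))"
    by (subst sum.swap) (simp add: tail_avg_sum[OF c])
  also have "\<dots> \<le> (\<Sum>b\<in>B. 1)"
    using y by (intro sum_mono sum_tail_avg_has_vertex c) auto
  finally show ?thesis by simp
qed

text \<open>The vertices that are robust by themselves, for a system \<open>K\<close> of robust sets, and the
  partners of a vertex in robust pairs. Pairs that contain a single robust vertex are redundant.\<close>

definition singles :: "(nat \<times> nat) set set \<Rightarrow> (nat \<times> nat) set" where
  "singles K = {e. {e} \<in> K}"

definition nbrs :: "(nat \<times> nat) set set \<Rightarrow> nat \<times> nat \<Rightarrow> (nat \<times> nat) set" where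
  "nbrs K e = {u. {e, u} \<in> K \<and> u \<notin> singles K \<and> fst u \<noteq> fst e}"

text \<open>A bound, up to a constant factor, for the variance that is contributed by coordinate \<open>c\<close>.\<close>

definition coord_cost :: "nat \<Rightarrow> nat \<Rightarrow> (nat \<times> nat) set set \<Rightarrow> nat \<Rightarrow> real" where
  "coord_cost n m K c = (\<Sum>v\<in>{1..n}. if (c, v) \<in> singles K then real m else real (card (nbrs K (c, v)))) / real n"

text \<open>Revealing coordinate \<open>c + 1\<close> by a random permutation \<open>\<pi>\<close>. Row \<open>j\<close> and column \<open>v\<close> of the matrix \<open>a\<close>
  hold the new conditional probability that the \<open>j\<close>-th tuple is hit, if its next entry is \<open>v\<close>. Compare it with the
  probability \<open>g\<close> of a hit by the sets that do not use this coordinate, which depends on the row alone.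
  If the vertex \<open>(c + 1, v)\<close> is single, the entry is \<open>1\<close>: up to a column constant the
  deviation is \<open>- g\<close>, and the sum of \<open>g\<close> over the rows is at most the size of a cover, hence at most \<open>m\<close>. If it is
  not, the excess over \<open>g\<close> is at most the expected number of its partners in the tuple; summed over the rows this
  is at most the number of partners.\<close>

lemma coordinate_step:
  fixes y :: "nat \<Rightarrow> nat \<Rightarrow> nat"
  assumes c: "c < k" and n: "0 < n" and y: "\<And>i. i \<in> {1..c} \<Longrightarrow> inj_on (\<lambda>j. y j i) {1..n}"
    and K2: "\<And>S. S \<in> K \<Longrightarrow> finite S \<and> card S \<le> 2"
    and B: "finite B" "card B \<le> m" "\<And>S. S \<in> K \<Longrightarrow> S \<inter> B \<noteq> {}"
    and nb: "\<And>e. e \<notin> singles K \<Longrightarrow> finite (nbrs K e)"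
    and \<theta>: "0 \<le> \<theta>" "\<theta> \<le> 1/4"
  shows "(\<Sum>\<pi> | \<pi> permutes {1..n}.
      exp (- \<theta> * (\<Sum>j\<in>{1..n}. tail_avg n k (Suc c) (hits k K) ((y j)(Suc c := \<pi> j))))) \<le>
    card {\<pi>. \<pi> permutes {1..n}} *
    exp (- \<theta> * (\<Sum>j\<in>{1..n}. tail_avg n k c (hits k K) (y j)) + 4 * \<theta>\<^sup>2 * coord_cost n m K (Suc c))"
proof -
  have Sc: "Suc c \<le> k" and c': "c \<le> k" using c by auto
  define K' where "K' = {S\<in>K. Suc c \<notin> fst ` S}"
  define P where "P = tail_avg n k (Suc c) (hits k K)"
  define g where "g = tail_avg n k (Suc c) (hits k K')"
  define a where "a j v = P ((y j)(Suc c := v))" for j v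
  define w :: "nat \<Rightarrow> real" where "w v = of_bool ((Suc c, v) \<in> singles K)" for v
  \<comment> \<open>the deviation from the row and column constants, split into its positive and its negative part\<close>
  define p where "p j v = (if (Suc c, v) \<in> singles K then 0 else a j v - g (y j))" for j v
  define q where "q j v = (if (Suc c, v) \<in> singles K then g (y j) else 0)" for j v
  let ?A = "{1..n}"
  have A: "finite ?A" "?A \<noteq> {}" using n by auto
  have K'hits: "hits k K' (x(Suc c := v)) = hits k K' x" for x v
  proof -
    have "S \<subseteq> gr k (x(Suc c := v)) \<longleftrightarrow> S \<subseteq> gr k x" if "S \<in> K'" for S
    proof -
      have "e \<in> gr k (x(Suc c := v)) \<longleftrightarrow> e \<in> gr k x" if "e \<in> S" for e
        using that \<open>S \<in> K'\<close> unfolding K'_def by (cases e) (force simp: mem_gr)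
      then show ?thesis by blast
    qed
    then have "(\<exists>S\<in>K'. S \<subseteq> gr k (x(Suc c := v))) \<longleftrightarrow> (\<exists>S\<in>K'. S \<subseteq> gr k x)"
      by (intro bex_cong refl)
    then show ?thesis unfolding hits_def by (rule arg_cong)
  qed
  have g_indep: "g (x(Suc c := v)) = g x" for x v
    unfolding g_def using Sc K'hits by (rule tail_avg_indep)
  have P01: "0 \<le> P x" "P x \<le> 1" and g01: "0 \<le> g x" "g x \<le> 1" for x
    unfolding P_def g_def using tail_avg_hits_bounds[OF Sc n] by auto
  have gP: "g x \<le> P x" for x
    unfolding P_def g_def by (intro tail_avg_mono Sc hits_mono) (auto simp: K'_def)
  have single1: "a j v = 1" if "(Suc c, v) \<in> singles K" for j v
  proof -
    have "has_vertex k (Suc c, v) x \<le> hits k K x" for x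
      using that by (auto simp: has_vertex_def hits_def singles_def)
    then have "tail_avg n k (Suc c) (has_vertex k (Suc c, v)) ((y j)(Suc c := v)) \<le> a j v"
      unfolding a_def P_def by (intro tail_avg_mono Sc)
    also have "tail_avg n k (Suc c) (has_vertex k (Suc c, v)) ((y j)(Suc c := v)) = 1"
      using Sc n by (subst tail_avg_has_vertex_past) (auto simp: has_vertex_def mem_gr)
    finally show ?thesis using P01(2) unfolding a_def by (simp add: order_antisym)
  qed
  have dec: "a j v = g (y j) + w v + p j v - q j v" for j v
    using single1[of v j] by (simp add: w_def p_def q_def)
  have p01: "0 \<le> p j v \<and> p j v \<le> 1" for j v
    using gP[of "(y j)(Suc c := v)"] g01(1)[of "y j"] P01(2)[of "(y j)(Suc c := v)"]
    unfolding p_def a_def g_indep by auto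
  have q01: "0 \<le> q j v \<and> q j v \<le> 1" for j v
    using g01 unfolding q_def by auto
  have mean_a: "perm_mean ?A a = (\<Sum>j\<in>?A. tail_avg n k c (hits k K) (y j))"
    unfolding perm_mean_def[OF A] tail_avg_step[OF c] avg_coord_def a_def P_def
    by (simp add: sum_divide_distrib)
  have sum_q: "(\<Sum>j\<in>?A. q j v) \<le> (if (Suc c, v) \<in> singles K then real m else 0)" for v
  proof -
    have "(\<Sum>j\<in>?A. g (y j)) = (\<Sum>j\<in>?A. tail_avg n k c (hits k K') (y j))"
      using n by (simp add: tail_avg_step[OF c] avg_coord_def g_indep flip: g_def)
    also have "\<dots> \<le> real (card B)"
      using c' n y B by (intro sum_tail_avg_cover) (auto simp: K'_def)
    also have "\<dots> \<le> real m" using B by simp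
    finally show ?thesis by (simp add: q_def)
  qed
  have sum_p: "(\<Sum>j\<in>?A. p j v) \<le> (if (Suc c, v) \<in> singles K then 0 else real (card (nbrs K (Suc c, v))))" for v
  proof (cases "(Suc c, v) \<in> singles K")
    case True
    then show ?thesis by (simp add: p_def)
  next
    case False
    let ?e = "(Suc c, v)"
    \<comment> \<open>the last summand makes the inequality trivial for tuples that avoid the vertex \<open>(c + 1, v)\<close>, so that it can be averaged over all tuples\<close>
    have pt: "hits k K x \<le> hits k K' x + ((\<Sum>u\<in>nbrs K ?e. has_vertex k u x) + (1 + - has_vertex k ?e x))" for x
    proof (cases "hits k K x = 1 \<and> hits k K' x = 0 \<and> ?e \<in> gr k x")
      case True
      then obtain S where S: "S \<in> K" "S \<subseteq> gr k x" by (auto simp: hits_def)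
      have noK': "\<not> S' \<subseteq> gr k x" if "S' \<in> K" "Suc c \<notin> fst ` S'" for S'
        using True that by (auto simp: hits_def K'_def)
      have "Suc c \<in> fst ` S" using noK' S by blast
      then obtain v' where v': "(Suc c, v') \<in> S" by auto
      have "v' = v" using v' S(2) True by (metis mem_gr subsetD)
      then have eS: "?e \<in> S" using v' by simp
      have "S \<noteq> {?e}" using False S(1) by (auto simp: singles_def)
      then obtain u where u: "u \<in> S" "u \<noteq> ?e" using eS by blast
      have Seq: "S = {?e, u}"
      proof -
        have "{?e, u} \<subseteq> S" using eS u by simp
        moreover have "card S \<le> card {?e, u}" using K2[OF S(1)] u by simp
        ultimately show ?thesis using card_seteq[of S "{?e, u}"] K2[OF S(1)] by simp
      qed
      have ugr: "u \<in> gr k x" using u S by blast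
      have fu: "fst u \<noteq> Suc c"
      proof
        assume "fst u = Suc c"
        then have "snd u = x (Suc c)" using ugr by (cases u) (simp add: mem_gr)
        moreover have "x (Suc c) = v" using True by (simp add: mem_gr)
        ultimately show False using u(2) \<open>fst u = Suc c\<close> by (cases u) simp
      qed
      have "u \<notin> singles K"
      proof
        assume "u \<in> singles K"
        then show False using noK'[of "{u}"] fu ugr by (auto simp: singles_def)
      qed
      then have "u \<in> nbrs K ?e" using Seq S(1) fu by (simp add: nbrs_def)
      then have "has_vertex k u x \<le> (\<Sum>u\<in>nbrs K ?e. has_vertex k u x)"
        using nb[OF False] by (intro member_le_sum) auto
      moreover have "has_vertex k u x = 1" using ugr by (simp add: has_vertex_def)
      moreover have "has_vertex k ?e x \<le> 1" by (simp add: has_vertex_def)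
      ultimately show ?thesis using hits_bounds[of k K x] hits_bounds[of k K' x] by linarith
    next
      case False
      have "0 \<le> (\<Sum>u\<in>nbrs K ?e. has_vertex k u x)" by (intro sum_nonneg) simp
      then show ?thesis using False by (auto simp: hits_def has_vertex_def)
    qed
    have "a j v \<le> g (y j) + (\<Sum>u\<in>nbrs K ?e. tail_avg n k (Suc c) (has_vertex k u) (y j))" for j
    proof -
      let ?x = "(y j)(Suc c := v)"
      have "a j v \<le> tail_avg n k (Suc c) (\<lambda>x. hits k K' x +
          ((\<Sum>u\<in>nbrs K ?e. has_vertex k u x) + (1 + - has_vertex k ?e x))) ?x"
        unfolding a_def P_def by (intro tail_avg_mono Sc pt)
      also have "\<dots> = g ?x + ((\<Sum>u\<in>nbrs K ?e. tail_avg n k (Suc c) (has_vertex k u) ?x) +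
          (1 - tail_avg n k (Suc c) (has_vertex k ?e) ?x))"
        by (simp only: tail_avg_add[OF Sc] tail_avg_sum[OF Sc n] tail_avg_const[OF Sc n]
            tail_avg_uminus[OF Sc] g_def diff_conv_add_uminus)
      also have "tail_avg n k (Suc c) (has_vertex k ?e) ?x = 1"
        using Sc n by (subst tail_avg_has_vertex_past) (auto simp: has_vertex_def mem_gr)
      also have "(\<Sum>u\<in>nbrs K ?e. tail_avg n k (Suc c) (has_vertex k u) ?x) =
          (\<Sum>u\<in>nbrs K ?e. tail_avg n k (Suc c) (has_vertex k u) (y j))"
        by (intro sum.cong refl tail_avg_indep Sc has_vertex_upd) (simp add: nbrs_def)
      finally show ?thesis unfolding g_indep by simp
    qed
    then have "(\<Sum>j\<in>?A. p j v) \<le> (\<Sum>j\<in>?A. \<Sum>u\<in>nbrs K ?e. tail_avg n k (Suc c) (has_vertex k u) (y j))"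
      using False by (intro sum_mono) (auto simp: p_def algebra_simps)
    also have "\<dots> = (\<Sum>u\<in>nbrs K ?e. \<Sum>j\<in>?A. tail_avg n k (Suc c) (has_vertex k u) (y j))"
      by (rule sum.swap)
    also have "\<dots> \<le> (\<Sum>u\<in>nbrs K ?e. 1)"
    proof (intro sum_mono sum_tail_avg_has_vertex Sc n)
      fix u assume u: "u \<in> nbrs K ?e" "fst u \<le> Suc c" "fst u \<in> {1..k}"
      then have "fst u \<in> {1..c}" by (auto simp: nbrs_def)
      then show "inj_on (\<lambda>j. y j (fst u)) ?A" by (rule y)
    qed
    finally show ?thesis using False by simp
  qed
  have "perm_mean ?A p + perm_mean ?A q = (\<Sum>v\<in>?A. (\<Sum>j\<in>?A. p j v) + (\<Sum>j\<in>?A. q j v)) / n"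
    unfolding perm_mean_def[OF A] sum.distrib add_divide_distrib
    by (subst (1 2) sum.swap) (simp only: card_atLeastAtMost diff_Suc_1)
  also have "\<dots> \<le> coord_cost n m K (Suc c)"
    unfolding coord_cost_def
  proof (intro divide_right_mono sum_mono)
    fix v
    show "(\<Sum>j\<in>?A. p j v) + (\<Sum>j\<in>?A. q j v) \<le>
      (if (Suc c, v) \<in> singles K then real m else real (card (nbrs K (Suc c, v))))"
      using sum_p[of v] sum_q[of v] by (auto split: if_splits)
  qed simp
  finally have cost: "perm_mean ?A p + perm_mean ?A q \<le> coord_cost n m K (Suc c)" .
  have "(\<Sum>\<pi> | \<pi> permutes ?A. exp (- \<theta> * (perm_sum ?A a \<pi> - perm_mean ?A a)))
    \<le> card {\<pi>. \<pi> permutes ?A} * exp (4 * \<theta>\<^sup>2 * (perm_mean ?A p + perm_mean ?A q))"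
    using dec p01 q01 by (intro perm_sum_lower_mgf[OF A _ _ _ \<theta>]) auto
  also have "\<dots> \<le> card {\<pi>. \<pi> permutes ?A} * exp (4 * \<theta>\<^sup>2 * coord_cost n m K (Suc c))"
    using cost by (intro mult_left_mono) (auto intro: mult_left_mono)
  finally have "(\<Sum>\<pi> | \<pi> permutes ?A. exp (- \<theta> * (perm_sum ?A a \<pi> - perm_mean ?A a))) * exp (- \<theta> * perm_mean ?A a)
      \<le> card {\<pi>. \<pi> permutes ?A} * exp (4 * \<theta>\<^sup>2 * coord_cost n m K (Suc c)) * exp (- \<theta> * perm_mean ?A a)"
    by (rule mult_right_mono) simp
  also have "(\<Sum>\<pi> | \<pi> permutes ?A. exp (- \<theta> * (perm_sum ?A a \<pi> - perm_mean ?A a))) * exp (- \<theta> * perm_mean ?A a)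
      = (\<Sum>\<pi> | \<pi> permutes ?A. exp (- \<theta> * perm_sum ?A a \<pi>))"
    unfolding sum_distrib_right exp_add[symmetric] by (simp add: algebra_simps)
  finally show ?thesis
    unfolding mean_a unfolding perm_sum_def[OF A] a_def P_def mult.assoc exp_add[symmetric]
    by (simp add: add.commute)
qed

section \<open>Matchings that are hit often\<close>

text \<open>The single vertices belong to the cover \<open>B\<close>, and a pair without single vertices meets the rest of \<open>B\<close>. So if there
  are \<open>t\<close> single vertices, there are at most \<open>(m - t) m\<close> such pairs, each counted from both of its ends, against a
  cost \<open>m\<close> for each single vertex.\<close>

lemma total_cost:
  assumes n: "0 < n" and KV: "\<And>S. S \<in> K \<Longrightarrow> S \<subseteq> {1..k} \<times> {1..n}"
    and B: "finite B" "card B \<le> m" "\<And>S. S \<in> K \<Longrightarrow> S \<inter> B \<noteq> {}"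
    and nb: "\<And>e. e \<notin> singles K \<Longrightarrow> finite (nbrs K e) \<and> card (nbrs K e) \<le> m"
  shows "(\<Sum>c\<in>{1..k}. coord_cost n m K c) \<le> 2 * (real m)\<^sup>2 / real n"
proof -
  define V where "V = {1..k} \<times> {1..n}"
  define T where "T = singles K"
  define D where "D = V \<inter> B - T"
  define P where "P = (SIGMA e:V - T. nbrs K e)"
  define Q where "Q = (SIGMA e:D. nbrs K e)"
  have finV: "finite V" by (simp add: V_def)
  have TB: "T \<subseteq> V \<inter> B" using KV B(3) unfolding T_def V_def singles_def by blast
  have finT: "finite T" "finite D"
    using finV by (auto simp: D_def intro: finite_subset[OF TB])
  have finQ: "finite Q" unfolding Q_def using finT nb by (auto simp: D_def T_def)
  have "P \<subseteq> Q \<union> prod.swap ` Q"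
  proof
    fix eu assume "eu \<in> P"
    then obtain e u where eu: "eu = (e, u)" "e \<in> V" "e \<notin> T" "u \<in> nbrs K e" by (auto simp: P_def)
    then have u: "{e, u} \<in> K" "u \<notin> T" "fst u \<noteq> fst e" by (auto simp: nbrs_def T_def)
    then have uV: "u \<in> V" using KV[OF u(1)] by (simp add: V_def)
    have "{u, e} \<in> K" using u(1) by (simp add: insert_commute)
    then have "e \<in> nbrs K u" using u eu by (simp add: nbrs_def T_def)
    moreover have "e \<in> B \<or> u \<in> B" using B(3)[OF u(1)] by auto
    ultimately show "eu \<in> Q \<union> prod.swap ` Q"
      using eu u uV unfolding Q_def D_def by (force simp: image_iff)
  qed
  then have "card P \<le> card (Q \<union> prod.swap ` Q)" using finQ by (intro card_mono) auto
  also have "\<dots> \<le> card Q + card (prod.swap ` Q)" by (rule card_Un_le)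
  also have "\<dots> \<le> 2 * card Q" using card_image_le[OF finQ, of prod.swap] by simp
  also have "card Q = (\<Sum>e\<in>D. card (nbrs K e))"
    unfolding Q_def using finT nb by (intro card_SigmaI) (auto simp: D_def T_def)
  also have "\<dots> \<le> (\<Sum>e\<in>D. m)" using nb by (intro sum_mono) (auto simp: D_def T_def)
  finally have cP: "card P \<le> 2 * (card D * m)" by simp
  have "card T + card D = card (T \<union> D)"
    using finT by (intro card_Un_disjoint[symmetric]) (auto simp: D_def)
  also have "\<dots> \<le> card B" using TB B(1) by (intro card_mono) (auto simp: D_def)
  finally have cTD: "card T + card D \<le> m" using B(2) by simp
  have "(\<Sum>c\<in>{1..k}. \<Sum>v\<in>{1..n}. if (c, v) \<in> T then m else card (nbrs K (c, v))) =
      (\<Sum>e\<in>V. if e \<in> T then m else card (nbrs K e))"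
    unfolding V_def by (simp add: sum.cartesian_product)
  also have "\<dots> = (\<Sum>e\<in>V \<inter> T. m) + (\<Sum>e\<in>V - T. card (nbrs K e))"
    using finV by (subst sum.If_cases) (auto simp: Diff_eq)
  also have "(\<Sum>e\<in>V - T. card (nbrs K e)) = card P"
    unfolding P_def using finV nb by (intro card_SigmaI[symmetric]) (auto simp: T_def)
  also have "(\<Sum>e\<in>V \<inter> T. m) = card T * m" 
  proof -
    have "V \<inter> T = T" using TB by blast
    then show ?thesis by simp
  qed
  also have "card T * m + card P \<le> card T * m + 2 * (card D * m)" using cP by simp
  also have "\<dots> \<le> 2 * ((card T + card D) * m)" by (simp add: algebra_simps)
  also have "\<dots> \<le> 2 * (m * m)" using cTD by (intro mult_left_mono mult_right_mono) auto
  finally have *: "(\<Sum>c\<in>{1..k}. \<Sum>v\<in>{1..n}. if (c, v) \<in> T then m else card (nbrs K (c, v))) \<le> 2 * (m * m)" .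
  have "(\<Sum>c\<in>{1..k}. coord_cost n m K c) =
      (\<Sum>c\<in>{1..k}. \<Sum>v\<in>{1..n}. if (c, v) \<in> T then real m else real (card (nbrs K (c, v)))) / real n"
    unfolding coord_cost_def T_def by (rule sum_divide_distrib[symmetric])
  also have "(\<Sum>c\<in>{1..k}. \<Sum>v\<in>{1..n}. if (c, v) \<in> T then real m else real (card (nbrs K (c, v)))) =
      real (\<Sum>c\<in>{1..k}. \<Sum>v\<in>{1..n}. if (c, v) \<in> T then m else card (nbrs K (c, v)))"
    unfolding of_nat_sum by (intro sum.cong refl) simp
  also have "\<dots> / real n \<le> real (2 * (m * m)) / real n"
    using * by (intro divide_right_mono) (simp_all only: of_nat_le_iff of_nat_0_le_iff)
  finally show ?thesis by (simp add: power2_eq_square)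
qed

text \<open>The potential \<open>\<Sum>\<^sub>i \<Phi> c y i\<close> equals \<open>card J\<close> before any coordinate is revealed. The average of the next value over all
  permutations is at most the current value, so some permutation keeps it at most \<open>card J\<close>.\<close>

lemma matching_with_many_hits:
  fixes \<theta> :: real
  assumes n: "0 < n" and J: "finite J"
    and KV: "\<And>i S. i \<in> J \<Longrightarrow> S \<in> K i \<Longrightarrow> S \<subseteq> {1..k} \<times> {1..n} \<and> card S \<le> 2"
    and B: "\<And>i. i \<in> J \<Longrightarrow> \<exists>B. finite B \<and> card B \<le> m \<and> (\<forall>S\<in>K i. S \<inter> B \<noteq> {})"
    and nb: "\<And>i e. i \<in> J \<Longrightarrow> e \<notin> singles (K i) \<Longrightarrow> finite (nbrs (K i) e) \<and> card (nbrs (K i) e) \<le> m"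
    and \<theta>: "0 \<le> \<theta>" "\<theta> \<le> 1/4"
  shows "\<exists>x. (\<forall>j\<in>{1..n}. x j \<in> tuples n k) \<and> (\<forall>c\<in>{1..k}. inj_on (\<lambda>j. x j c) {1..n}) \<and>
    (\<forall>i\<in>J. exp (- \<theta> * (\<Sum>j\<in>{1..n}. hits k (K i) (x j))
        + \<theta> * (real n * ((\<Sum>x\<in>tuples n k. hits k (K i) x) / real n ^ k))
        - 4 * \<theta>\<^sup>2 * (2 * (real m)\<^sup>2 / real n)) \<le> real (card J))"
proof -
  define W where "W i = real n * ((\<Sum>x\<in>tuples n k. hits k (K i) x) / real n ^ k)" for i
  define \<Phi> where "\<Phi> c y i = exp (- \<theta> * (\<Sum>j\<in>{1..n}. tail_avg n k c (hits k (K i)) (y j)) + \<theta> * W i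
      - 4 * \<theta>\<^sup>2 * (\<Sum>c'\<in>{1..c}. coord_cost n m (K i) c'))" for c i and y :: "nat \<Rightarrow> nat \<Rightarrow> nat"
  have "\<exists>y. (\<forall>j\<in>{1..n}. y j \<in> {1..c} \<rightarrow>\<^sub>E {1..n}) \<and> (\<forall>i\<in>{1..c}. inj_on (\<lambda>j. y j i) {1..n}) \<and>
      (\<Sum>i\<in>J. \<Phi> c y i) \<le> real (card J)" if "c \<le> k" for c
    using that
  proof (induction c)
    case 0
    have "\<Phi> 0 (\<lambda>_ _. undefined) i = 1" for i
      unfolding \<Phi>_def W_def tail_avg_0[OF n] by simp
    then show ?case by (intro exI[of _ "\<lambda>_ _. undefined"]) simp
  next
    case (Suc c)
    from Suc.IH[OF Suc_leD[OF Suc.prems]] obtain y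
      where y': "\<forall>j\<in>{1..n}. y j \<in> {1..c} \<rightarrow>\<^sub>E {1..n}"
      and inj': "\<forall>i\<in>{1..c}. inj_on (\<lambda>j. y j i) {1..n}"
      and \<Phi>y: "(\<Sum>i\<in>J. \<Phi> c y i) \<le> real (card J)" by blast
    have y: "y j \<in> {1..c} \<rightarrow>\<^sub>E {1..n}" if "j \<in> {1..n}" for j using y' that by blast
    have inj: "inj_on (\<lambda>j. y j i) {1..n}" if "i \<in> {1..c}" for i using inj' that by blast
    let ?P = "{\<pi>. \<pi> permutes {1..n}}"
    define z where "z \<pi> j = (y j)(Suc c := \<pi> j)" for \<pi> j
    have finP: "finite ?P" by (simp add: finite_permutations)
    have Pne: "?P \<noteq> {}" using permutes_id[of "{1..n}"] by blast
    have step: "(\<Sum>\<pi>\<in>?P. \<Phi> (Suc c) (z \<pi>) i) \<le> real (card ?P) * \<Phi> c y i" if i: "i \<in> J" for i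
    proof -
      obtain B where B': "finite B" "card B \<le> m" "\<And>S. S \<in> K i \<Longrightarrow> S \<inter> B \<noteq> {}"
        using B[OF i] by blast
      have fin2: "finite S \<and> card S \<le> 2" if "S \<in> K i" for S
      proof
        show "finite S" by (rule finite_subset[of S "{1..k} \<times> {1..n}"]) (use KV[OF i that] in auto)
        show "card S \<le> 2" using KV[OF i that] by simp
      qed
      \<comment> \<open>the part of the exponent that does not depend on \<open>\<pi>\<close>\<close>
      define r where "r = exp (\<theta> * W i - 4 * \<theta>\<^sup>2 * (\<Sum>c'\<in>{1..Suc c}. coord_cost n m (K i) c'))"
      have "(\<Sum>\<pi>\<in>?P. \<Phi> (Suc c) (z \<pi>) i) = (\<Sum>\<pi>\<in>?P. exp (- \<theta> * (\<Sum>j\<in>{1..n}.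
          tail_avg n k (Suc c) (hits k (K i)) ((y j)(Suc c := \<pi> j))))) * r"
        unfolding sum_distrib_right \<Phi>_def z_def r_def exp_add[symmetric]
        by (intro sum.cong refl arg_cong[where f = exp]) simp
      also have "\<dots> \<le> (card ?P * exp (- \<theta> * (\<Sum>j\<in>{1..n}. tail_avg n k c (hits k (K i)) (y j)) +
          4 * \<theta>\<^sup>2 * coord_cost n m (K i) (Suc c))) * r"
        using Suc.prems nb[OF i] \<theta> n
        by (intro mult_right_mono coordinate_step[OF _ _ inj fin2 B']) (auto simp: r_def)
      also have "\<dots> = card ?P * \<Phi> c y i"
        unfolding \<Phi>_def r_def mult.assoc exp_add[symmetric]
        by (simp add: algebra_simps)
      finally show ?thesis .
    qed
    have "(\<Sum>\<pi>\<in>?P. \<Sum>i\<in>J. \<Phi> (Suc c) (z \<pi>) i) = (\<Sum>i\<in>J. \<Sum>\<pi>\<in>?P. \<Phi> (Suc c) (z \<pi>) i)"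
      by (rule sum.swap)
    also have "\<dots> \<le> (\<Sum>i\<in>J. real (card ?P) * \<Phi> c y i)" by (intro sum_mono step)
    also have "\<dots> = real (card ?P) * (\<Sum>i\<in>J. \<Phi> c y i)" by (simp add: sum_distrib_left)
    also have "\<dots> \<le> real (card ?P) * real (card J)" using \<Phi>y by (intro mult_left_mono) auto
    also have "\<dots> = (\<Sum>\<pi>\<in>?P. real (card J))" by simp
    finally have le: "(\<Sum>\<pi>\<in>?P. \<Sum>i\<in>J. \<Phi> (Suc c) (z \<pi>) i) \<le> (\<Sum>\<pi>\<in>?P. real (card J))" .
    have "\<exists>\<pi>\<in>?P. (\<Sum>i\<in>J. \<Phi> (Suc c) (z \<pi>) i) \<le> real (card J)"
    proof (rule ccontr)
      assume "\<not> ?thesis"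
      then have "(\<Sum>\<pi>\<in>?P. real (card J)) < (\<Sum>\<pi>\<in>?P. \<Sum>i\<in>J. \<Phi> (Suc c) (z \<pi>) i)"
        using finP Pne by (intro sum_strict_mono) auto
      then show False using le by simp
    qed
    then obtain \<pi> where \<pi>: "\<pi> permutes {1..n}" "(\<Sum>i\<in>J. \<Phi> (Suc c) (z \<pi>) i) \<le> real (card J)" by auto
    have range: "z \<pi> j \<in> {1..Suc c} \<rightarrow>\<^sub>E {1..n}" if "j \<in> {1..n}" for j
    proof -
      have "{1..Suc c} = insert (Suc c) {1..c}" by auto
      then show ?thesis
        using y[OF that] permutes_in_image[OF \<pi>(1), of j] that
        unfolding z_def by (simp only: PiE_fun_upd)
    qed
    have "inj_on (\<lambda>j. z \<pi> j i) {1..n}" if "i \<in> {1..Suc c}" for i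
    proof (cases "i = Suc c")
      case True
      then show ?thesis using permutes_inj_on[OF \<pi>(1)] by (simp add: z_def inj_on_def)
    next
      case False
      then show ?thesis using inj[of i] that by (simp add: z_def)
    qed
    then show ?case using range \<pi>(2) by (intro exI[of _ "z \<pi>"]) blast
  qed
  from this[of k] obtain x where x: "\<forall>j\<in>{1..n}. x j \<in> {1..k} \<rightarrow>\<^sub>E {1..n}"
    "\<forall>i\<in>{1..k}. inj_on (\<lambda>j. x j i) {1..n}" "(\<Sum>i\<in>J. \<Phi> k x i) \<le> real (card J)" by auto
  have "exp (- \<theta> * (\<Sum>j\<in>{1..n}. hits k (K i) (x j)) + \<theta> * W i - 4 * \<theta>\<^sup>2 * (2 * (real m)\<^sup>2 / real n))
      \<le> real (card J)" if i: "i \<in> J" for i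
  proof -
    obtain B where B': "finite B" "card B \<le> m" "\<And>S. S \<in> K i \<Longrightarrow> S \<inter> B \<noteq> {}"
      using B[OF i] by blast
    have "(\<Sum>c\<in>{1..k}. coord_cost n m (K i) c) \<le> 2 * (real m)\<^sup>2 / real n"
      using KV[OF i] nb[OF i] by (intro total_cost[OF n _ B']) auto
    then have "4 * \<theta>\<^sup>2 * (\<Sum>c\<in>{1..k}. coord_cost n m (K i) c) \<le> 4 * \<theta>\<^sup>2 * (2 * (real m)\<^sup>2 / real n)"
      by (rule mult_left_mono) simp
    then have "exp (- \<theta> * (\<Sum>j\<in>{1..n}. hits k (K i) (x j)) + \<theta> * W i - 4 * \<theta>\<^sup>2 * (2 * (real m)\<^sup>2 / real n))
        \<le> \<Phi> k x i" unfolding \<Phi>_def by simp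
    also have "\<dots> \<le> (\<Sum>i\<in>J. \<Phi> k x i)"
      using J i by (intro member_le_sum) (auto simp: \<Phi>_def)
    finally show ?thesis using x(3) by linarith
  qed
  then show ?thesis using x unfolding W_def tuples_def by blast
qed

text \<open>Greedy choice: the \<open>i\<close>-th set has an element other than the \<open>i - 1\<close> elements chosen before.\<close>

lemma distinct_representatives:
  fixes A :: "nat \<Rightarrow> 'a set"
  assumes "\<And>i. i \<in> {1..s} \<Longrightarrow> finite (A i) \<and> i \<le> card (A i)"
  shows "\<exists>t. (\<forall>i\<in>{1..s}. t i \<in> A i) \<and> inj_on t {1..s}"
  using assms
proof (induction s)
  case (Suc s)
  have "\<exists>t. (\<forall>i\<in>{1..s}. t i \<in> A i) \<and> inj_on t {1..s}"
    by (rule Suc.IH, rule Suc.prems) simp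
  then obtain t where t: "\<forall>i\<in>{1..s}. t i \<in> A i" "inj_on t {1..s}" by blast
  have "Suc s \<le> card (A (Suc s))" using Suc.prems[of "Suc s"] by simp
  moreover have "card (t ` {1..s}) \<le> s" using card_image_le[of "{1..s}" t] by simp
  ultimately have "\<not> A (Suc s) \<subseteq> t ` {1..s}"
    using card_mono[of "t ` {1..s}" "A (Suc s)"] by (meson finite_atLeastAtMost finite_imageI le_trans not_less_eq_eq)
  then obtain a where a: "a \<in> A (Suc s)" "a \<notin> t ` {1..s}" by blast
  have ins: "{1..Suc s} = insert (Suc s) {1..s}" by auto
  have new: "(t(Suc s := a)) i = t i" if "i \<in> {1..s}" for i using that by simp
  have img: "(t(Suc s := a)) ` {1..s} = t ` {1..s}" by (rule image_cong[OF refl new])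
  have inj: "inj_on (t(Suc s := a)) {1..s}"
    using t(2) by (simp only: inj_on_cong[of "{1..s}" "t(Suc s := a)" t, OF new])
  show ?case
  proof (intro exI[of _ "t(Suc s := a)"] conjI)
    show "\<forall>i\<in>{1..Suc s}. (t(Suc s := a)) i \<in> A i"
      unfolding ins using t(1) a(1) by simp
    have "{1..s} - {Suc s} = {1..s}" by auto
    then show "inj_on (t(Suc s := a)) {1..Suc s}"
      unfolding ins inj_on_insert using inj a(2) by (simp only: img fun_upd_same simp_thms)
  qed
qed simp

section \<open>The theorem\<close>

text \<open>The choice of \<open>\<theta>\<close>. Unconstrained, the exponent \<open>- \<theta> \<lambda> + 32 \<theta>\<^sup>2 s\<^sup>2 / n\<close> is least at
  \<open>\<theta> = \<lambda> n / (64 s\<^sup>2)\<close>; there the first lower bound on \<open>\<lambda>\<close> is what is needed. If this value exceeds the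
  admissible range, the second lower bound on \<open>\<lambda>\<close> takes over at \<open>\<theta> = 1/4\<close>.\<close>

lemma hits_of_exponential_bound:
  fixes L lam m n s k h i W :: real
  assumes s: "1 \<le> s" and k: "1 \<le> k" and n: "0 < n"
    and L: "0 < L" "s \<le> exp L"
    and lam: "14 * s * sqrt (L / n) \<le> lam" "8 * k * L \<le> lam"
    and m: "0 \<le> m" "m \<le> 2 * s"
    and bound: "\<And>\<theta>. 0 \<le> \<theta> \<Longrightarrow> \<theta> \<le> 1/4 \<Longrightarrow> \<theta> = min (1/4) (lam * n / (64 * s\<^sup>2)) \<Longrightarrow>
      exp (- \<theta> * h + \<theta> * W - 4 * \<theta>\<^sup>2 * (2 * m\<^sup>2 / n)) \<le> s"
    and W: "i + lam < W"
  shows "i \<le> h"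
proof (rule ccontr)
  assume "\<not> i \<le> h"
  then have gap: "lam < W - h" using W by simp
  define \<theta> where "\<theta> = min (1/4) (lam * n / (64 * s\<^sup>2))"
  have lamp: "0 < lam"
  proof -
    have "0 < 8 * k * L" using k L by simp
    then show ?thesis using lam by linarith
  qed
  have \<theta>: "0 < \<theta>" "\<theta> \<le> 1/4" "\<theta> \<le> lam * n / (64 * s\<^sup>2)"
    unfolding \<theta>_def using lamp n s by auto
  have "exp (- \<theta> * h + \<theta> * W - 4 * \<theta>\<^sup>2 * (2 * m\<^sup>2 / n)) \<le> exp L"
    using order_trans[OF bound[OF _ \<theta>(2) \<theta>_def] L(2)] \<theta>(1) by simp
  then have e: "\<theta> * (W - h) - 4 * \<theta>\<^sup>2 * (2 * m\<^sup>2 / n) \<le> L" by (simp add: algebra_simps)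
  have "4 * \<theta>\<^sup>2 * (2 * m\<^sup>2 / n) \<le> 4 * \<theta>\<^sup>2 * (2 * (2 * s)\<^sup>2 / n)"
    using m n by (intro mult_left_mono divide_right_mono power_mono) auto
  also have "\<dots> = \<theta> * (\<theta> * (32 * s\<^sup>2 / n))" by (simp add: power2_eq_square)
  also have "\<dots> \<le> \<theta> * (lam / 2)"
  proof (rule mult_left_mono)
    have "\<theta> * (32 * s\<^sup>2 / n) \<le> lam * n / (64 * s\<^sup>2) * (32 * s\<^sup>2 / n)"
      using \<theta> n by (intro mult_right_mono) auto
    also have "\<dots> = lam / 2" using s n by (simp add: field_simps)
    finally show "\<theta> * (32 * s\<^sup>2 / n) \<le> lam / 2" .
  qed (use \<theta> in simp)
  finally have q: "4 * \<theta>\<^sup>2 * (2 * m\<^sup>2 / n) \<le> \<theta> * (lam / 2)" .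
  have "\<theta> * lam < \<theta> * (W - h)" using gap \<theta> by simp
  moreover have "\<theta> * (lam / 2) = \<theta> * lam / 2" by simp
  ultimately have lt: "\<theta> * lam / 2 < L" using e q by linarith
  show False
  proof (cases "1/4 \<le> lam * n / (64 * s\<^sup>2)")
    case True
    then have quarter: "\<theta> = 1/4" by (simp add: \<theta>_def)
    have "lam < 8 * L" using lt unfolding quarter by linarith
    moreover have "8 * L \<le> 8 * k * L" using k L by simp
    ultimately show False using lam by linarith
  next
    case False
    then have t: "\<theta> = lam * n / (64 * s\<^sup>2)" by (simp add: \<theta>_def)
    have "(14 * s * sqrt (L / n))\<^sup>2 \<le> lam\<^sup>2"
      using lam s L n by (intro power_mono) auto
    then have "196 * s\<^sup>2 * (L / n) \<le> lam\<^sup>2"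
      using L n by (simp add: power_mult_distrib)
    then have "196 * s\<^sup>2 * (L / n) * (n / (128 * s\<^sup>2)) \<le> lam\<^sup>2 * (n / (128 * s\<^sup>2))"
      using n by (intro mult_right_mono) auto
    moreover have "lam\<^sup>2 * (n / (128 * s\<^sup>2)) = \<theta> * lam / 2"
      unfolding t by (simp add: power2_eq_square)
    moreover have "196 * s\<^sup>2 * (L / n) * (n / (128 * s\<^sup>2)) = 196 / 128 * L"
      using n s by (simp add: field_simps)
    ultimately show False using lt L by linarith
  qed
qed

theorem theorem1p5:
  fixes n s k :: nat and c :: real
  assumes "n > 0" and "s > 0" and "k > 0"
    and "real n > max (2 ^ 5 * real s * log 2 (real s * real k)) (real s)"
    and "c \<ge> real n ^ (k - 1)
           + max (14 * real s * real n powr (real k - 3 / 2) * sqrt (ln (2 * real k * real s)))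
                 (8 * real k * real n ^ (k - 1) * ln (2 * real k * real s))
           + 2 ^ 15 * real s ^ 3 * (log 2 (real k * real s)) ^ 3 * real n powr (real k - 3)"
  shows "satisfying n s k (\<lambda>i. (real i - 1) * real n ^ (k - 1) + c)"
  unfolding satisfying_def
proof (intro allI impI)
  fix F :: "nat \<Rightarrow> (nat \<Rightarrow> nat) set"
  assume hyp: "\<forall>i\<in>{1..s}. F i \<subseteq> tuples n k \<and> (real i - 1) * real n ^ (k - 1) + c < real (card (F i))"
  have n: "0 < n" and s1: "1 \<le> s" and k1: "1 \<le> k" using assms by auto
  define L where "L = ln (2 * real k * real s)"
  define l where "l = log 2 (real s * real k)"
  define R where "R = 32 * real s * l"
  have ks: "1 \<le> real k * real s" using s1 k1 mult_mono[of 1 "real k" 1 "real s"] by simp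
  have L0: "0 < L" unfolding L_def using ks by (simp add: mult.assoc)
  have l0: "0 \<le> l" unfolding l_def using ks by (simp add: mult.commute)
  have R0: "0 \<le> R" unfolding R_def using l0 by simp
  define dev where "dev = max (14 * real s * real n powr (real k - 3 / 2) * sqrt L) (8 * real k * real n ^ (k - 1) * L)"
  have R3: "R ^ 3 = 2 ^ 15 * real s ^ 3 * l ^ 3"
    unfolding R_def by (simp add: power_mult_distrib)
  have c_ge: "real n ^ (k - 1) + dev + R ^ 3 * real n powr (real k - 3) \<le> c"
    using assms(5) unfolding R3 dev_def L_def l_def by (simp add: mult.commute[of "real s" "real k"])
  have dev0: "0 \<le> dev" unfolding dev_def using L0 by (auto simp: max_def)
  have rem0: "0 \<le> R ^ 3 * real n powr (real k - 3)" using R0 by simp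
  show "\<exists>x. rainbow_matching s k F x"
  \<comment> \<open>for \<open>s = 1\<close> the logarithm may vanish and spreadness is void, but any tuple will do\<close>
  proof (cases "s = 1")
    case True
    have "0 < card (F 1)"
    proof -
      have "0 \<le> c" using c_ge dev0 rem0 by (smt (verit) of_nat_0_le_iff zero_le_power)
      then show ?thesis using hyp True by fastforce
    qed
    then obtain x where "x \<in> F 1" by fastforce
    then show ?thesis
      unfolding rainbow_matching_def using True by (intro exI[of _ "\<lambda>_. x"]) (simp add: pairwise_def)
  next
    case False
    then have s2: "2 \<le> s" using s1 by simp
    have l1: "1 \<le> l"
    proof -
      have "2 \<le> real s * real k" using s2 k1 mult_mono[of 2 "real s" 1 "real k"] by simp
      then show ?thesis unfolding l_def by (simp add: le_log_iff)
    qed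
    have Rn: "R \<le> real n" "real s < real n" using assms(4) unfolding R_def l_def by simp_all
    have R1: "1 \<le> R"
    proof -
      have "32 * real s * 1 \<le> R" unfolding R_def using l1 by (intro mult_left_mono) auto
      then show ?thesis using s1 by linarith
    qed
    define V where "V = {1..k} \<times> {1..n}"
    define m where "m = 2 * (s - 1)"
    define \<S> where "\<S> i = {S. card S \<le> 2 \<and> spread_core R k (F i) S}" for i
    define K where "K i = {S. S \<subseteq> V \<and> card S \<le> 2 \<and> robust m (\<S> i) S}" for i
    define J where "J = {i\<in>{1..s}. {} \<notin> K i}"
    have finV: "finite V" by (simp add: V_def)
    have FT: "F i \<subseteq> tuples n k" "(real i - 1) * real n ^ (k - 1) + c < real (card (F i))" if "i \<in> {1..s}" for i
      using hyp that by auto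
    have J_s: "i \<in> {1..s}" "\<not> robust m (\<S> i) {}" if "i \<in> J" for i
      using that by (auto simp: J_def K_def)
    define lam where "lam = dev / real n ^ (k - 1)"
    define W where "W i = real n * ((\<Sum>x\<in>tuples n k. hits k (K i) x) / real n ^ k)" for i
    \<comment> \<open>\<open>W i\<close> is the expected number of tuples above a robust set in a random partition\<close>
    have W_gt: "real i + lam < W i" if i: "i \<in> {1..s}" for i
    proof -
      let ?U = "{x\<in>F i. \<not> (\<exists>S. card S \<le> 2 \<and> S \<subseteq> gr k x \<and> spread_core R k (F i) S)}"
      let ?H = "{x\<in>tuples n k. \<exists>S\<in>K i. S \<subseteq> gr k x}"
      have U: "real (card ?U) \<le> R ^ 3 * real n powr (real k - 3)"
        using card_uncovered_by_cores[OF FT(1)[OF i] R1 Rn(1), of 2] by (simp add: numeral_3_eq_3)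
      \<comment> \<open>a tuple above a small core lies above a robust set, since members are robust\<close>
      have "F i \<subseteq> ?U \<union> ?H"
      proof
        fix x assume x: "x \<in> F i"
        show "x \<in> ?U \<union> ?H"
        proof (cases "x \<in> ?U")
          case False
          then obtain S where S: "card S \<le> 2" "S \<subseteq> gr k x" "spread_core R k (F i) S" using x by blast
          have "S \<subseteq> V" using S(2) gr_subset[of x n k] FT(1)[OF i] x unfolding V_def by blast
          moreover have "robust m (\<S> i) S" using S by (intro robust_mem) (simp add: \<S>_def)
          ultimately have "S \<in> K i" using S by (simp add: K_def)
          then show ?thesis using S x FT(1)[OF i] by blast
        qed blast
      qed
      moreover have "finite (?U \<union> ?H)"
        using FT(1)[OF i] by (auto intro: finite_subset[OF _ finite_tuples[of n k]])
      ultimately have "card (F i) \<le> card (?U \<union> ?H)" by (intro card_mono)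
      also have "\<dots> \<le> card ?U + card ?H" by (rule card_Un_le)
      finally have "real (card (F i)) \<le> real (card ?U) + real (card ?H)" by linarith
      then have "(real i - 1) * real n ^ (k - 1) + (real n ^ (k - 1) + dev) < real (card ?H)"
        using FT(2)[OF i] U c_ge by linarith
      then have H: "real i * real n ^ (k - 1) + dev < real (card ?H)" by (simp add: algebra_simps)
      have "(\<Sum>x\<in>tuples n k. hits k (K i) x) = real (card ?H)"
        by (simp add: hits_def of_bool_def sum.If_cases Int_def)
      then have "W i = real (card ?H) / real n ^ (k - 1)"
        using n k1 unfolding W_def by (cases k) simp_all
      moreover have "real i + lam = (real i * real n ^ (k - 1) + dev) / real n ^ (k - 1)"
        using n by (simp add: lam_def add_divide_distrib)
      ultimately show ?thesis using H n by (simp add: divide_strict_right_mono)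
    qed
    have lam1: "14 * real s * sqrt (L / real n) \<le> lam"
    proof -
      have "real n powr (real k - 3 / 2) / real n ^ (k - 1) = 1 / sqrt (real n)"
      proof -
        have "real n ^ (k - 1) = real n powr (real k - 1)"
          using n k1 by (simp add: of_nat_diff flip: powr_realpow)
        then have "real n powr (real k - 3 / 2) / real n ^ (k - 1) = real n powr (- (1 / 2))"
          by (simp add: powr_diff[symmetric])
        also have "\<dots> = 1 / sqrt (real n)" using n by (simp add: powr_minus powr_half_sqrt field_simps)
        finally show ?thesis .
      qed
      moreover have "14 * real s * real n powr (real k - 3 / 2) * sqrt L / real n ^ (k - 1) =
          14 * real s * sqrt L * (real n powr (real k - 3 / 2) / real n ^ (k - 1))" by simp
      ultimately have "14 * real s * real n powr (real k - 3 / 2) * sqrt L / real n ^ (k - 1) = 14 * real s * sqrt (L / real n)"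
        by (simp only: real_sqrt_divide) simp
      moreover have "14 * real s * real n powr (real k - 3 / 2) * sqrt L / real n ^ (k - 1) \<le> lam"
        unfolding lam_def dev_def by (intro divide_right_mono) auto
      ultimately show ?thesis by simp
    qed
    have lam2: "8 * real k * L \<le> lam"
    proof -
      have "8 * real k * L = 8 * real k * real n ^ (k - 1) * L / real n ^ (k - 1)" using n by simp
      also have "\<dots> \<le> lam" unfolding lam_def dev_def by (intro divide_right_mono) auto
      finally show ?thesis .
    qed
    define \<theta> where "\<theta> = min (1/4) (lam * real n / (64 * (real s)\<^sup>2))"
    have "0 \<le> lam" unfolding lam_def using dev0 by simp
    then have \<theta>: "0 \<le> \<theta>" "\<theta> \<le> 1/4" unfolding \<theta>_def by auto
    have sing: "{e} \<in> K i" if "robust m (\<S> i) {e}" "e \<in> V" for i e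
      using that by (simp add: K_def)
    have "\<exists>x. (\<forall>j\<in>{1..n}. x j \<in> tuples n k) \<and> (\<forall>c\<in>{1..k}. inj_on (\<lambda>j. x j c) {1..n}) \<and>
      (\<forall>i\<in>J. exp (- \<theta> * (\<Sum>j\<in>{1..n}. hits k (K i) (x j)) + \<theta> * W i
        - 4 * \<theta>\<^sup>2 * (2 * (real m)\<^sup>2 / real n)) \<le> real (card J))"
      unfolding W_def
    proof (rule matching_with_many_hits[OF n])
      show "finite J" by (simp add: J_def)
      show "0 \<le> \<theta>" "\<theta> \<le> 1/4" by fact+
      show "S \<subseteq> {1..k} \<times> {1..n} \<and> card S \<le> 2" if "S \<in> K i" for i S
        using that by (simp add: K_def V_def)
      show "\<exists>B. finite B \<and> card B \<le> m \<and> (\<forall>S\<in>K i. S \<inter> B \<noteq> {})" if iJ: "i \<in> J" for i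
      proof -
        obtain B where "finite B" "card B \<le> m" "\<And>S. robust m (\<S> i) S \<Longrightarrow> S \<inter> B \<noteq> {}"
          using robust_cover[OF J_s(2)[OF iJ]] by blast
        then show ?thesis by (intro exI[of _ B]) (auto simp: K_def)
      qed
      show "finite (nbrs (K i) e) \<and> card (nbrs (K i) e) \<le> m" if e: "e \<notin> singles (K i)" for i e
      proof (cases "e \<in> V")
        case False
        then have "nbrs (K i) e = {}" by (auto simp: nbrs_def K_def)
        then show ?thesis by simp
      next
        case True
        then have "\<not> robust m (\<S> i) {e}" using e sing unfolding singles_def by blast
        from card_robust_neighbours[OF this]
        have fin: "finite {u. robust m (\<S> i) {e, u}}" and le: "card {u. robust m (\<S> i) {e, u}} \<le> m" by auto
        have sub: "nbrs (K i) e \<subseteq> {u. robust m (\<S> i) {e, u}}" by (auto simp: nbrs_def K_def)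
        show ?thesis using finite_subset[OF sub fin] card_mono[OF fin sub] le by simp
      qed
    qed
    then obtain x where x: "\<forall>j\<in>{1..n}. x j \<in> tuples n k" "\<forall>c\<in>{1..k}. inj_on (\<lambda>j. x j c) {1..n}"
      "\<forall>i\<in>J. exp (- \<theta> * (\<Sum>j\<in>{1..n}. hits k (K i) (x j)) + \<theta> * W i
        - 4 * \<theta>\<^sup>2 * (2 * (real m)\<^sup>2 / real n)) \<le> real (card J)" by blast
    define A where "A i = {j\<in>{1..n}. \<exists>S\<in>K i. S \<subseteq> gr k (x j)}" for i
    have A: "finite (A i) \<and> i \<le> card (A i)" if i: "i \<in> {1..s}" for i
    proof
      show "finite (A i)" by (simp add: A_def)
      show "i \<le> card (A i)"
      proof (cases "i \<in> J")
        case False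
        then have "{} \<in> K i" using i by (simp add: J_def)
        \<comment> \<open>the robust empty set lies below every tuple\<close>
        then have "A i = {1..n}" by (auto simp: A_def)
        then show ?thesis using i Rn(2) by simp
      next
        case True
        have hits: "(\<Sum>j\<in>{1..n}. hits k (K i) (x j)) = real (card (A i))"
          by (simp add: hits_def of_bool_def sum.If_cases Int_def A_def)
        have cJ: "real (card J) \<le> real s"
        proof -
          have "card J \<le> card {1..s}" by (intro card_mono) (auto simp: J_def)
          then show ?thesis by simp
        qed
        have "real i \<le> real (card (A i))"
        proof (rule hits_of_exponential_bound[where s = "real s" and k = "real k" and n = "real n" and L = L and lam = lam
              and m = "real m" and W = "W i"])
          show "real s \<le> exp L"
          proof -
            have "real s * 1 \<le> real s * (2 * real k)" using k1 by (intro mult_left_mono) auto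
            then show ?thesis unfolding L_def using ks by (simp add: mult_ac)
          qed
          show "real m \<le> 2 * real s" by (simp add: m_def)
          fix t assume "t = min (1/4) (lam * real n / (64 * (real s)\<^sup>2))"
          then have "t = \<theta>" by (simp add: \<theta>_def)
          then show "exp (- t * real (card (A i)) + t * W i - 4 * t\<^sup>2 * (2 * (real m)\<^sup>2 / real n)) \<le> real s"
            using x(3) True cJ unfolding hits[symmetric] by force
        qed (use s1 k1 n L0 lam1 lam2 W_gt[OF i] in auto)
        then show ?thesis by simp
      qed
    qed
    obtain t where t: "\<forall>i\<in>{1..s}. t i \<in> A i" "inj_on t {1..s}"
      using distinct_representatives[of s A] A by blast
    have "\<forall>i\<in>{1..s}. \<exists>S. S \<in> K i \<and> S \<subseteq> gr k (x (t i))" using t(1) by (auto simp: A_def)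
    from bchoice[OF this] obtain S where S: "\<forall>i\<in>{1..s}. S i \<in> K i \<and> S i \<subseteq> gr k (x (t i))" by blast
    have gr_disj: "gr k (x a) \<inter> gr k (x b) = {}" if "a \<in> {1..n}" "b \<in> {1..n}" "a \<noteq> b" for a b
    proof -
      have "x a i \<noteq> x b i" if "i \<in> {1..k}" for i
        using x(2) that \<open>a \<in> {1..n}\<close> \<open>b \<in> {1..n}\<close> \<open>a \<noteq> b\<close> unfolding inj_on_def by blast
      then have "disjoint_tuples k (x a) (x b)" by (simp add: disjoint_tuples_def)
      then show ?thesis by (simp add: disjoint_tuples_gr)
    qed
    have "\<exists>S'. (\<forall>i\<in>{1..s}. S' i \<in> \<S> i) \<and> (\<forall>i\<in>{1..s}. \<forall>j\<in>{1..s}. i \<noteq> j \<longrightarrow> S' i \<inter> S' j = {})"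
    proof (rule replace_robust_by_members[where q = 2 and m = m and K = S])
      show "finite {1..s}" by simp
      show "2 * (card {1..s} - 1) \<le> m" by (simp add: m_def)
      show "finite S' \<and> card S' \<le> 2" if "S' \<in> \<S> i" for i S'
        using that spread_core_finite by (auto simp: \<S>_def)
      show "finite (S i) \<and> card (S i) \<le> 2 \<and> robust m (\<S> i) (S i)" if "i \<in> {1..s}" for i
      proof -
        have "S i \<in> K i" using S that by blast
        then have "S i \<subseteq> V" "card (S i) \<le> 2" "robust m (\<S> i) (S i)" by (auto simp: K_def)
        then show ?thesis using finite_subset[OF _ finV] by simp
      qed
      show "S i \<inter> S j = {}" if ij: "i \<in> {1..s}" "j \<in> {1..s}" "i \<noteq> j" for i j
      proof -
        have "t i \<noteq> t j" using t(2) ij by (auto dest: inj_onD)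
        moreover have "t i \<in> {1..n}" "t j \<in> {1..n}" using t(1) ij unfolding A_def by blast+
        ultimately have "gr k (x (t i)) \<inter> gr k (x (t j)) = {}" by (intro gr_disj)
        moreover have "S i \<subseteq> gr k (x (t i))" "S j \<subseteq> gr k (x (t j))" using S ij by auto
        ultimately show ?thesis by blast
      qed
    qed
    then obtain S' where S': "\<forall>i\<in>{1..s}. S' i \<in> \<S> i" "\<forall>i\<in>{1..s}. \<forall>j\<in>{1..s}. i \<noteq> j \<longrightarrow> S' i \<inter> S' j = {}"
      by blast
    show ?thesis
    proof (rule rainbow_matching_of_cores[OF s2 k1, where S = S' and R = R and n = n])
      show "32 * real s * log 2 (real s * real k) \<le> R" by (simp add: R_def l_def)
      show "F i \<subseteq> tuples n k" if "i \<in> {1..s}" for i using FT(1)[OF that] .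
      show "spread_core R k (F i) (S' i)" "card (S' i) \<le> 2" if "i \<in> {1..s}" for i
        using S'(1) that by (auto simp: \<S>_def)
      show "S' i \<inter> S' j = {}" if "i \<in> {1..s}" "j \<in> {1..s}" "i \<noteq> j" for i j
        using S'(2) that by blast
    qed
  qed
qed

end
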